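(* Consider the two-source state $\rho_s$, $s=(s_1,s_2,s_3)\in\mathbb R^3$, on $L^2(D_a)$, where $D_a$ is the disk of radius $a$, and let $\{|Z_n^m\rangle\}$ be the orthonormal Zernike basis. The projective measurement consisting of $$\Pi_2=|Z_1^1\rangle\langle Z_1^1|,\quad \Pi_3=|Z_1^{-1}\rangle\langle Z_1^{-1}|,\quad \Pi_4=|Z_2^0\rangle\langle Z_2^0|,\quad \Pi_1=1-\Pi_2-\Pi_3-\Pi_4$$ is optimal in the limit $s\to0$ for the estimation of all three parameters $s_1,s_2,s_3$: for each of these four projectors the matrix bound of the classical Fisher information is saturated in the limit $s\to0$.
   Context: State. Fix $a>0$ and $k>0$. For $s=(s_1,s_2,s_3)$, $s_\perp=(s_1,s_2)$ and $r=(x_1,x_2)\in D_a=\{|r|\le a\}$, let $\Phi_s(r)=\frac{1}{\sqrt\pi\,a}\exp[\mathrm i k(s_\perp\cdot r-s_3|r|^2/2)]$. The one-photon state of two incoherent point sources at $\pm s$ is $\rho_s=\tfrac12|\Phi_s\rangle\langle\Phi_s|+\tfrac12|\Phi_{-s}\rangle\langle\Phi_{-s}|$ (rank $2$ for $s\ne0$, rank $1$ at $s=0$). Write $\partial_i=\partial/\partial s_i$. Zernike basis. For integers $n\ge0$ and $m$ with $|m|\le n$, $n-|m|$ even, in polar coordinates $(|r|,\phi)$, $Z_n^m$ is the $L^2(D_a)$-normalized multiple of $R_n^{|m|}(|r|/a)\cos(m\phi)$ for $m\ge0$ and of $R_n^{|m|}(|r|/a)\sin(|m|\phi)$ for $m<0$,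 where $R_n^{m}(\varrho)=\sum_{l=0}^{(n-m)/2}\frac{(-1)^l(n-l)!}{l!\,(\frac{n+m}2-l)!\,(\frac{n-m}2-l)!}\varrho^{n-2l}$. These form an orthonormal basis of $L^2(D_a)$. Fisher information of a projector $\Pi$. For $s\neq0$, $L_{is}$ is a bounded self-adjoint solution of $\tfrac12(L_{is}\rho_s+\rho_sL_{is})=\partial_i\rho_s$ and $\mathcal I_{ij}(s)=\operatorname{Re}\operatorname{Tr}(\rho_sL_{is}\Pi L_{js})$, $i,j\in\{1,2,3\}$. With $h(s)=\operatorname{Tr}(\rho_s\Pi)$, $\mathcal F_{ij}(s)=\partial_ih(s)\partial_jh(s)/h(s)$ where $h(s)>0$. One has $\mathcal F\le\mathcal I$ as matrices. Saturation in the limit $s\to0$: if $h(0)>0$ ($\Pi$ regular), it means $\lim_{t\to0}\mathcal F(tv)=\lim_{t\to0}\mathcal I(tv)$ for every $v\in\mathbb R^3\setminus\{0\}$. If $h(0)=0$ ($\Pi$ null), it means the same equality for every $v$ with $\sum_{p,q}\partial_p\partial_qh(0)v_pv_q>0$; if the Hessian of $h$ at $0$ is zero, the limit of $\mathcal F$ is taken to be $0$ for every $v\neq 0$. *)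

theory Defs
  imports "HOL-Analysis.Analysis"
begin

section \<open>The Hilbert space of square-integrable functions on the disk\<close>

text \<open>Elements of $L^2(D_a)$ are represented by functions on the plane; only their values on the
  disk, up to null sets, matter. Equality of vectors is therefore always stated almost everywhere.\<close>

type_synonym wave = "real \<times> real \<Rightarrow> complex"
type_synonym oper = "wave \<Rightarrow> wave"

definition disk :: "real \<Rightarrow> (real \<times> real) measure" where
  "disk a = lebesgue_on (cball 0 a)"

definition L2 :: "real \<Rightarrow> wave set" where
  "L2 a = {f \<in> borel_measurable (disk a). integrable (disk a) (\<lambda>r. (cmod (f r))\<^sup>2)}"

text \<open>Conjugate-linear in the first argument, as in the bra-ket notation.\<close>

definition braket :: "real \<Rightarrow> wave \<Rightarrow> wave \<Rightarrow> complex" where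
  "braket a f g = (LINT r|disk a. cnj (f r) * g r)"

definition l2norm :: "real \<Rightarrow> wave \<Rightarrow> real" where
  "l2norm a f = sqrt (LINT r|disk a. (cmod (f r))\<^sup>2)"

definition oper_eq :: "real \<Rightarrow> oper \<Rightarrow> oper \<Rightarrow> bool" where
  "oper_eq a A B \<longleftrightarrow> (\<forall>f\<in>L2 a. AE r in disk a. A f r = B f r)"

definition bounded_oper :: "real \<Rightarrow> oper \<Rightarrow> bool" where
  "bounded_oper a A \<longleftrightarrow>
     (\<forall>f\<in>L2 a. A f \<in> L2 a) \<and>
     (\<forall>f\<in>L2 a. \<forall>g\<in>L2 a. \<forall>c. AE r in disk a. A (\<lambda>x. c * f x + g x) r = c * A f r + A g r) \<and>
     (\<exists>C. \<forall>f\<in>L2 a. l2norm a (A f) \<le> C * l2norm a f)"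

definition selfadjoint_oper :: "real \<Rightarrow> oper \<Rightarrow> bool" where
  "selfadjoint_oper a A \<longleftrightarrow> (\<forall>f\<in>L2 a. \<forall>g\<in>L2 a. braket a (A f) g = braket a f (A g))"

definition ketbra :: "real \<Rightarrow> wave \<Rightarrow> wave \<Rightarrow> oper" where
  "ketbra a u v = (\<lambda>f r. u r * braket a v f)"

text \<open>The trace of a finite-rank operator: the linear extension of
  $\mathrm{Tr}\,|u\rangle\langle v| = \langle v|u\rangle$.
  All operators whose trace is taken below contain a factor of rank at most two.\<close>

definition has_oper_trace :: "real \<Rightarrow> oper \<Rightarrow> complex \<Rightarrow> bool" where
  "has_oper_trace a A t \<longleftrightarrow>
     (\<exists>(n::nat) u v. (\<forall>j<n. u j \<in> L2 a \<and> v j \<in> L2 a) \<and>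
        oper_eq a A (\<lambda>f r. \<Sum>j<n. ketbra a (u j) (v j) f r) \<and>
        t = (\<Sum>j<n. braket a (v j) (u j)))"

definition oper_trace :: "real \<Rightarrow> oper \<Rightarrow> complex" where
  "oper_trace a A = (THE t. has_oper_trace a A t)"


section \<open>Partial derivatives with respect to the source position\<close>

definition partial_deriv :: "3 \<Rightarrow> (real^3 \<Rightarrow> real) \<Rightarrow> real^3 \<Rightarrow> real" where
  "partial_deriv i f s = deriv (\<lambda>t. f (s + t *\<^sub>R axis i 1)) 0"

text \<open>Operator-valued partial derivative: the difference quotients converge to \<open>D\<close> in operator
  norm.\<close>

definition has_oper_partial_deriv ::
    "real \<Rightarrow> 3 \<Rightarrow> (real^3 \<Rightarrow> oper) \<Rightarrow> oper \<Rightarrow> real^3 \<Rightarrow> bool" where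
  "has_oper_partial_deriv a i R D s \<longleftrightarrow>
     bounded_oper a D \<and>
     (\<forall>\<epsilon>>0. \<forall>\<^sub>F t in at (0::real). \<forall>f\<in>L2 a.
        l2norm a (\<lambda>r. (R (s + t *\<^sub>R axis i 1) f r - R s f r) / of_real t - D f r)
          \<le> \<epsilon> * l2norm a f)"


section \<open>The two-source state\<close>

definition Phi :: "real \<Rightarrow> real \<Rightarrow> real^3 \<Rightarrow> wave" where
  "Phi a k s r = of_real (1 / (sqrt pi * a)) *
     exp (\<i> * of_real (k * (s$1 * fst r + s$2 * snd r - s$3 * (norm r)\<^sup>2 / 2)))"

definition rho :: "real \<Rightarrow> real \<Rightarrow> real^3 \<Rightarrow> oper" where
  "rho a k s = (\<lambda>f r. (1/2) * ketbra a (Phi a k s) (Phi a k s) f r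
                     + (1/2) * ketbra a (Phi a k (- s)) (Phi a k (- s)) f r)"


section \<open>Zernike basis\<close>

definition zernike_radial :: "nat \<Rightarrow> nat \<Rightarrow> real \<Rightarrow> real" where
  "zernike_radial n m x =
     (\<Sum>l=0..(n - m) div 2. (-1) ^ l * fact (n - l) /
        (fact l * fact ((n + m) div 2 - l) * fact ((n - m) div 2 - l)) * x ^ (n - 2 * l))"

definition polar_angle :: "real \<times> real \<Rightarrow> real" where
  "polar_angle r = Arg (Complex (fst r) (snd r))"

definition zernike_unnormalized :: "real \<Rightarrow> nat \<Rightarrow> int \<Rightarrow> wave" where
  "zernike_unnormalized a n m r =
     of_real (zernike_radial n (nat \<bar>m\<bar>) (norm r / a) *
       (if m \<ge> 0 then cos (of_int m * polar_angle r) else sin (of_int \<bar>m\<bar> * polar_angle r)))"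

definition zernike :: "real \<Rightarrow> nat \<Rightarrow> int \<Rightarrow> wave" where
  "zernike a n m r = zernike_unnormalized a n m r / of_real (l2norm a (zernike_unnormalized a n m))"


section \<open>Quantum and classical Fisher information of a projector\<close>

text \<open>\<open>L\<close> is a symmetric logarithmic derivative: a bounded self-adjoint solution of
  $\frac12(L\rho_s + \rho_s L) = \partial_i\rho_s$.\<close>

definition is_sld :: "real \<Rightarrow> real \<Rightarrow> 3 \<Rightarrow> real^3 \<Rightarrow> oper \<Rightarrow> bool" where
  "is_sld a k i s L \<longleftrightarrow>
     bounded_oper a L \<and> selfadjoint_oper a L \<and>
     has_oper_partial_deriv a i (rho a k)
       (\<lambda>f r. (1/2) * (L (rho a k s f) r + rho a k s (L f) r)) s"

text \<open>For $s \ne 0$ the symmetric logarithmic derivatives are not unique (they are arbitrary on the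
  kernel of $\rho_s$), but the value of $\mathrm{Re}\,\mathrm{Tr}(\rho_s L_i \Pi L_j)$ does not
  depend on the choice. At $s = 0$ the matrix below is never used.\<close>

definition quantum_fisher :: "real \<Rightarrow> real \<Rightarrow> oper \<Rightarrow> real^3 \<Rightarrow> real^3^3" where
  "quantum_fisher a k P s = (\<chi> i j. THE x. \<exists>L :: 3 \<Rightarrow> oper.
     (\<forall>p. is_sld a k p s (L p)) \<and>
     x = Re (oper_trace a (rho a k s \<circ> L i \<circ> P \<circ> L j)))"

definition outcome_prob :: "real \<Rightarrow> real \<Rightarrow> oper \<Rightarrow> real^3 \<Rightarrow> real" where
  "outcome_prob a k P s = Re (oper_trace a (rho a k s \<circ> P))"

definition classical_fisher :: "real \<Rightarrow> real \<Rightarrow> oper \<Rightarrow> real^3 \<Rightarrow> real^3^3" where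
  "classical_fisher a k P s = (\<chi> i j.
     partial_deriv i (outcome_prob a k P) s * partial_deriv j (outcome_prob a k P) s
       / outcome_prob a k P s)"

definition outcome_hessian :: "real \<Rightarrow> real \<Rightarrow> oper \<Rightarrow> 3 \<Rightarrow> 3 \<Rightarrow> real" where
  "outcome_hessian a k P p q = partial_deriv p (partial_deriv q (outcome_prob a k P)) 0"


section \<open>Saturation in the limit of vanishing separation\<close>

definition same_limit_along :: "real \<Rightarrow> real \<Rightarrow> oper \<Rightarrow> real^3 \<Rightarrow> bool" where
  "same_limit_along a k P v \<longleftrightarrow>
     (\<exists>M. ((\<lambda>t. classical_fisher a k P (t *\<^sub>R v)) \<longlongrightarrow> M) (at 0) \<and>
          ((\<lambda>t. quantum_fisher a k P (t *\<^sub>R v)) \<longlongrightarrow> M) (at 0))"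

text \<open>The last conjunct expresses the convention that the limit of the classical Fisher information
  is taken to be \<open>0\<close> when the Hessian vanishes.\<close>

definition saturated :: "real \<Rightarrow> real \<Rightarrow> oper \<Rightarrow> bool" where
  "saturated a k P \<longleftrightarrow>
     (outcome_prob a k P 0 > 0 \<longrightarrow> (\<forall>v. v \<noteq> 0 \<longrightarrow> same_limit_along a k P v)) \<and>
     (outcome_prob a k P 0 = 0 \<longrightarrow>
        (\<forall>v. (\<Sum>p\<in>UNIV. \<Sum>q\<in>UNIV. outcome_hessian a k P p q * v$p * v$q) > 0
             \<longrightarrow> same_limit_along a k P v) \<and>
        ((\<forall>p q. outcome_hessian a k P p q = 0) \<longrightarrow>
           (\<forall>v. v \<noteq> 0 \<longrightarrow> ((\<lambda>t. quantum_fisher a k P (t *\<^sub>R v)) \<longlongrightarrow> 0) (at 0))))"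

definition projective_measurement :: "real \<Rightarrow> oper list \<Rightarrow> bool" where
  "projective_measurement a Ps \<longleftrightarrow>
     (\<forall>P\<in>set Ps. bounded_oper a P \<and> selfadjoint_oper a P) \<and>
     (\<forall>i<length Ps. \<forall>j<length Ps.
        oper_eq a (Ps!i \<circ> Ps!j) (if i = j then Ps!i else (\<lambda>f r. 0))) \<and>
     oper_eq a (\<lambda>f r. \<Sum>P\<leftarrow>Ps. P f r) (\<lambda>f. f)"

definition optimal_at_zero :: "real \<Rightarrow> real \<Rightarrow> oper list \<Rightarrow> bool" where
  "optimal_at_zero a k Ps \<longleftrightarrow> projective_measurement a Ps \<and> (\<forall>P\<in>set Ps. saturated a k P)"

end

theory Submission
  imports Defs
begin

text \<open>
  Since $\Phi_{\pm s} = C \pm \mathrm{i} S$ with the real waves $C = N\cos\theta_s$ and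
  $S = N\sin\theta_s$, the state is $\rho_s = |C\rangle\langle C| + |S\rangle\langle S|$, with the
  kernel $N^2 \cos(\theta_s(r) - \theta_s(r'))$. Subtracting from the phase derivative
  $g_i = \partial_i \theta_s$ its mean does not change $\partial_i \rho_s$, and with the centred phase
  $\hat g_i$ one has $L_i C = -2 \hat g_i S$, $L_i S = 2 \hat g_i C$. Hence $\mathcal I_{ij}(s) =
  4 (\langle\hat g_i S|\Pi|\hat g_j S\rangle + \langle\hat g_i C|\Pi|\hat g_j C\rangle)$ is continuous at
  $s = 0$, where it equals $4 \langle\hat g_i \Phi_0|\Pi|\hat g_j \Phi_0\rangle$. For $\Pi = |z\rangle\langle z|$
  with $z$ real and of mean zero, the first-order expansion of $\langle z|\Phi_s\rangle$ gives the
  same limit for $\mathcal F_{ij}$. For the complementary projector both limits vanish, because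
  $\hat g_1, \hat g_2, \hat g_3$ are multiples of $Z_1^1, Z_1^{-1}, Z_2^0$.
\<close>

subsection \<open>The space of square-integrable functions on the disk\<close>

text \<open>The quantum Fisher information is a definite description over families of symmetric
  logarithmic derivatives, so two facts must be settled for every s \<noteq> 0 before a limit can be
  taken: such operators exist, and their values on C and S are forced up to null sets. The trace
  sees nothing else, since the range of the state is spanned by C and S. Existence is where s
  \<noteq> 0 matters: S vanishes identically at s = 0, whereas C and S must be linearly independent
  for values on them to be prescribed. A prescription on the span extends to a self-adjoint operator
  only if it is Hermitian there. The critical condition is that the integral of (phase derivative) *
  (C^2 + S^2) vanishes. As C^2 + S^2 is the constant 1/(pi a^2), subtracting the mean is exactly
  what achieves this. The same constancy makes the information of the identity independent of s, so
  the complementary projector is treated as the identity minus three rank-one terms.\<close>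

lemma space_disk: "space (disk a) = cball 0 a"
  by (simp add: disk_def space_restrict_space)

lemma finite_measure_disk: "finite_measure (disk a)"
proof
  have "emeasure lebesgue (cball (0::real \<times> real) a) < \<infinity>"
    using emeasure_lborel_cball_finite by auto
  then show "emeasure (disk a) (space (disk a)) \<noteq> \<infinity>"
    unfolding space_disk unfolding disk_def
    by (subst emeasure_restrict_space) auto
qed

lemma measurable_disk_continuous:
  fixes f :: "real \<times> real \<Rightarrow> 'a::{second_countable_topology, topological_space}"
  assumes "continuous_on UNIV f"
  shows "f \<in> borel_measurable (disk a)"
proof -
  have "f \<in> borel_measurable (lborel :: (real \<times> real) measure)"
    using borel_measurable_continuous_onI[OF assms] by simp
  then have "f \<in> borel_measurable (lebesgue :: (real \<times> real) measure)"
    by (rule measurable_completion)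
  then show ?thesis unfolding disk_def by (rule measurable_restrict_space1)
qed

text \<open>All concrete waves below are continuous on the whole plane, so this lemma settles their
  integrability. A continuous function is bounded on the compact disk, which has finite
  measure.\<close>

lemma integrable_disk_continuous:
  fixes f :: "real \<times> real \<Rightarrow> 'a::{second_countable_topology, banach}"
  assumes "continuous_on UNIV f"
  shows "integrable (disk a) f"
proof -
  have "compact (f ` cball 0 a)"
    by (intro compact_continuous_image continuous_on_subset[OF assms] subset_UNIV compact_cball)
  then have "bounded (f ` cball 0 a)" by (rule compact_imp_bounded)
  then obtain B where B: "\<forall>y\<in>f ` cball 0 a. norm y \<le> B" unfolding bounded_iff ..
  interpret finite_measure "disk a" by (rule finite_measure_disk)
  show ?thesis
    by (rule integrable_const_bound[where B = B])
      (use B in \<open>auto simp: space_disk intro!: AE_I2 measurable_disk_continuous[OF assms]\<close>)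
qed

lemma L2_continuous:
  assumes "continuous_on UNIV f"
  shows "f \<in> L2 a"
  unfolding L2_def
  by (auto intro!: measurable_disk_continuous[OF assms] integrable_disk_continuous continuous_intros assms)

lemma integrable_L2_product:
  assumes f: "f \<in> L2 a" and g: "g \<in> L2 a"
  shows "integrable (disk a) (\<lambda>r. cnj (f r) * g r)" "integrable (disk a) (\<lambda>r. f r * g r)"
    "integrable (disk a) (\<lambda>r. cmod (f r) * cmod (g r))"
proof -
  have [measurable]: "f \<in> borel_measurable (disk a)" "g \<in> borel_measurable (disk a)"
    and i: "integrable (disk a) (\<lambda>r. (cmod (f r))\<^sup>2)" "integrable (disk a) (\<lambda>r. (cmod (g r))\<^sup>2)"
    using f g by (auto simp: L2_def)
  have [measurable]: "(\<lambda>r. cnj (f r)) \<in> borel_measurable (disk a)"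
    by (rule borel_measurable_continuous_on[where f = cnj]) (auto intro!: continuous_intros)
  have b: "cmod x * cmod y \<le> (cmod x)\<^sup>2 + (cmod y)\<^sup>2" for x y
  proof -
    have "0 \<le> cmod x * cmod y" by simp
    then show ?thesis using sum_squares_bound[of "cmod x" "cmod y"] by linarith
  qed
  have ii: "integrable (disk a) (\<lambda>r. (cmod (f r))\<^sup>2 + (cmod (g r))\<^sup>2)" using i by simp
  have fg: "(\<lambda>r. f r * g r) \<in> borel_measurable (disk a)" "(\<lambda>r. cnj (f r) * g r) \<in> borel_measurable (disk a)"
    "(\<lambda>r. cmod (f r) * cmod (g r)) \<in> borel_measurable (disk a)" by measurable
  have bound: "integrable (disk a) h" if "h \<in> borel_measurable (disk a)" "\<And>r. norm (h r) = cmod (f r) * cmod (g r)"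
    for h :: "real \<times> real \<Rightarrow> 'b::{banach, second_countable_topology}"
    by (rule Bochner_Integration.integrable_bound[OF ii that(1)]) (simp add: that(2) b)
  show "integrable (disk a) (\<lambda>r. cnj (f r) * g r)" "integrable (disk a) (\<lambda>r. f r * g r)"
    "integrable (disk a) (\<lambda>r. cmod (f r) * cmod (g r))"
    by (rule bound[OF fg(2)], simp add: norm_mult) (rule bound[OF fg(1)], simp add: norm_mult,
        rule bound[OF fg(3)], simp)
qed

lemma L2_add:
  assumes f: "f \<in> L2 a" and g: "g \<in> L2 a"
  shows "(\<lambda>r. f r + g r) \<in> L2 a"
proof -
  have [measurable]: "f \<in> borel_measurable (disk a)" "g \<in> borel_measurable (disk a)"
    and i: "integrable (disk a) (\<lambda>r. (cmod (f r))\<^sup>2)" "integrable (disk a) (\<lambda>r. (cmod (g r))\<^sup>2)"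
    using f g by (auto simp: L2_def)
  have b: "(cmod (x + y))\<^sup>2 \<le> 2 * (cmod x)\<^sup>2 + 2 * (cmod y)\<^sup>2" for x y
  proof -
    have "(cmod (x + y))\<^sup>2 \<le> (cmod x + cmod y)\<^sup>2"
      by (intro power_mono norm_triangle_ineq norm_ge_zero)
    then show ?thesis using sum_squares_bound[of "cmod x" "cmod y"] by (simp add: power2_sum)
  qed
  have "integrable (disk a) (\<lambda>r. 2 * (cmod (f r))\<^sup>2 + 2 * (cmod (g r))\<^sup>2)" using i by simp
  then have "integrable (disk a) (\<lambda>r. (cmod (f r + g r))\<^sup>2)"
    by (rule Bochner_Integration.integrable_bound) (simp_all add: b)
  then show ?thesis by (auto simp: L2_def)
qed

lemma L2_scale: "f \<in> L2 a \<Longrightarrow> (\<lambda>r. c * f r) \<in> L2 a"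
  by (auto simp: L2_def norm_mult power_mult_distrib)

lemma L2_scale': "f \<in> L2 a \<Longrightarrow> (\<lambda>r. f r * c) \<in> L2 a"
  using L2_scale[of f a c] by (simp add: mult.commute)

lemma L2_uminus: "f \<in> L2 a \<Longrightarrow> (\<lambda>r. - f r) \<in> L2 a"
  using L2_scale[of f a "-1"] by simp

lemma L2_diff: "f \<in> L2 a \<Longrightarrow> g \<in> L2 a \<Longrightarrow> (\<lambda>r. f r - g r) \<in> L2 a"
  using L2_add[of f a "\<lambda>r. - g r"] L2_uminus[of g a] by simp

lemma L2_zero: "(\<lambda>r. 0) \<in> L2 a"
  by (simp add: L2_def)

lemma L2_sum: "(\<And>j. j \<in> J \<Longrightarrow> u j \<in> L2 a) \<Longrightarrow> (\<lambda>r. \<Sum>j\<in>J. u j r) \<in> L2 a"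
  by (induction J rule: infinite_finite_induct) (auto intro!: L2_zero L2_add)

lemmas L2_intros = L2_add L2_scale L2_scale' L2_uminus L2_diff L2_zero L2_sum

lemma measurable_L2: "f \<in> L2 a \<Longrightarrow> f \<in> borel_measurable (disk a)"
  by (simp add: L2_def)

lemma measurable_cnj: "f \<in> borel_measurable M \<Longrightarrow> (\<lambda>r. cnj (f r)) \<in> borel_measurable M"
  by (rule borel_measurable_continuous_on[where f = cnj]) (auto intro!: continuous_intros)

subsection \<open>The inner product\<close>

lemma braket_add_right:
  "f \<in> L2 a \<Longrightarrow> g \<in> L2 a \<Longrightarrow> h \<in> L2 a \<Longrightarrow> braket a f (\<lambda>r. g r + h r) = braket a f g + braket a f h"
  by (simp add: braket_def distrib_left integrable_L2_product)

lemma braket_diff_right: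
  "f \<in> L2 a \<Longrightarrow> g \<in> L2 a \<Longrightarrow> h \<in> L2 a \<Longrightarrow> braket a f (\<lambda>r. g r - h r) = braket a f g - braket a f h"
  by (simp add: braket_def right_diff_distrib integrable_L2_product)

lemma braket_scale_right: "braket a f (\<lambda>r. c * g r) = c * braket a f g"
proof -
  have "(\<lambda>r. cnj (f r) * (c * g r)) = (\<lambda>r. c * (cnj (f r) * g r))" by (auto simp: algebra_simps)
  then show ?thesis by (simp add: braket_def)
qed

lemma braket_scale_right': "braket a f (\<lambda>r. g r * c) = braket a f g * c"
  using braket_scale_right[of a f c g] by (simp add: mult.commute)

lemma braket_zero_right [simp]: "braket a f (\<lambda>r. 0) = 0"
  by (simp add: braket_def)

lemma braket_cnj: "cnj (braket a f g) = braket a g f"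
proof -
  have "cnj (braket a f g) = (LINT r|disk a. cnj (cnj (f r) * g r))"
    unfolding braket_def by (rule Bochner_Integration.integral_cnj[symmetric])
  also have "\<dots> = braket a g f" unfolding braket_def by (simp add: mult.commute)
  finally show ?thesis .
qed

lemma braket_add_left:
  "f \<in> L2 a \<Longrightarrow> g \<in> L2 a \<Longrightarrow> h \<in> L2 a \<Longrightarrow> braket a (\<lambda>r. g r + h r) f = braket a g f + braket a h f"
  using arg_cong[OF braket_add_right[of f a g h], of cnj] by (simp add: braket_cnj)

lemma braket_diff_left:
  "f \<in> L2 a \<Longrightarrow> g \<in> L2 a \<Longrightarrow> h \<in> L2 a \<Longrightarrow> braket a (\<lambda>r. g r - h r) f = braket a g f - braket a h f"
  using arg_cong[OF braket_diff_right[of f a g h], of cnj] by (simp add: braket_cnj)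

lemma braket_scale_left: "braket a (\<lambda>r. c * g r) f = cnj c * braket a g f"
  using arg_cong[OF braket_scale_right[of a f c g], of cnj] by (simp add: braket_cnj)

lemma braket_scale_left': "braket a (\<lambda>r. g r * c) f = braket a g f * cnj c"
  using arg_cong[OF braket_scale_right'[of a f g c], of cnj] by (simp add: braket_cnj)

lemma braket_uminus_right: "braket a f (\<lambda>r. - g r) = - braket a f g"
  using braket_scale_right[of a f "-1" g] by simp

lemma braket_uminus_left: "braket a (\<lambda>r. - g r) f = - braket a g f"
  using braket_scale_left[of a "-1" g f] by simp

lemma braket_sum_right:
  "f \<in> L2 a \<Longrightarrow> (\<And>j. j \<in> J \<Longrightarrow> u j \<in> L2 a) \<Longrightarrow>
    braket a f (\<lambda>r. \<Sum>j\<in>J. u j r) = (\<Sum>j\<in>J. braket a f (u j))"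
  by (induction J rule: infinite_finite_induct) (auto simp: braket_add_right L2_sum)

lemmas braket_linear = braket_add_right braket_diff_right braket_scale_right braket_scale_right'
  braket_add_left braket_diff_left braket_scale_left braket_scale_left'
  braket_uminus_right braket_uminus_left

lemma braket_cong_right:
  assumes "AE r in disk a. g r = h r" "f \<in> L2 a" "g \<in> L2 a" "h \<in> L2 a"
  shows "braket a f g = braket a f h"
  unfolding braket_def using assms
  by (intro integral_cong_AE borel_measurable_times measurable_cnj measurable_L2) auto

lemma braket_cong_left:
  assumes "AE r in disk a. g r = h r" "f \<in> L2 a" "g \<in> L2 a" "h \<in> L2 a"
  shows "braket a g f = braket a h f"
  using arg_cong[OF braket_cong_right[OF assms], of cnj] by (simp add: braket_cnj)

lemma braket_self: "braket a f f = of_real (LINT r|disk a. (cmod (f r))\<^sup>2)"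
proof -
  have "(\<lambda>r. cnj (f r) * f r) = (\<lambda>r. complex_of_real ((cmod (f r))\<^sup>2))"
    by (simp only: complex_norm_square mult.commute)
  then show ?thesis unfolding braket_def by (simp only: integral_complex_of_real)
qed

lemma l2norm_nonneg: "0 \<le> l2norm a f"
  by (simp add: l2norm_def)

lemma l2norm_square: "(l2norm a f)\<^sup>2 = (LINT r|disk a. (cmod (f r))\<^sup>2)"
  by (simp add: l2norm_def)

lemma AE_zero_if_l2norm_zero:
  assumes "f \<in> L2 a" "l2norm a f = 0"
  shows "AE r in disk a. f r = 0"
proof -
  have "(LINT r|disk a. (cmod (f r))\<^sup>2) = 0" using assms(2) l2norm_square[of a f] by simp
  then have "AE r in disk a. (cmod (f r))\<^sup>2 = 0"
    using assms(1) by (subst (asm) integral_nonneg_eq_0_iff_AE) (auto simp: L2_def)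
  then show ?thesis by simp
qed

lemma braket_eq_0_if_AE_zero:
  assumes "AE r in disk a. v r = 0" "f \<in> L2 a" "v \<in> L2 a"
  shows "braket a v f = 0" "braket a f v = 0"
  using braket_cong_left[OF assms(1,2,3) L2_zero] braket_cong_right[OF assms(1,2,3) L2_zero]
  by (auto simp: braket_def)

lemma braket_Cauchy_Schwarz:
  assumes f: "f \<in> L2 a" and g: "g \<in> L2 a"
  shows "cmod (braket a f g) \<le> l2norm a f * l2norm a g"
proof (cases "l2norm a f = 0 \<or> l2norm a g = 0")
  case True
  then have "braket a f g = 0"
    using AE_zero_if_l2norm_zero braket_eq_0_if_AE_zero f g by metis
  then show ?thesis by (simp add: l2norm_nonneg)
next
  case False
  \<comment> \<open>This weight balances 2xy \<le> t x^2 + y^2/t: after integration both terms on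
    the right equal the product of the two norms.\<close>
  define t where "t = l2norm a g / l2norm a f"
  have pos: "l2norm a f > 0" "l2norm a g > 0" "t > 0"
    using False l2norm_nonneg[of a f] l2norm_nonneg[of a g] by (auto simp: t_def)
  have i: "integrable (disk a) (\<lambda>r. (cmod (f r))\<^sup>2)" "integrable (disk a) (\<lambda>r. (cmod (g r))\<^sup>2)"
    using f g by (auto simp: L2_def)
  have b: "2 * (x * y) \<le> t * x\<^sup>2 + y\<^sup>2 / t" for x y :: real
  proof -
    have "0 \<le> (t * x - y)\<^sup>2 / t" using pos by simp
    also have "\<dots> = t * x\<^sup>2 + y\<^sup>2 / t - 2 * (x * y)"
      using pos by (simp add: field_simps power2_eq_square)
    finally show ?thesis by simp
  qed
  have "2 * cmod (braket a f g) \<le> 2 * (LINT r|disk a. cmod (f r) * cmod (g r))"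
    unfolding braket_def by (rule mult_left_mono, rule integral_norm_bound[THEN order_trans]) (auto simp: norm_mult)
  also have "\<dots> = (LINT r|disk a. 2 * (cmod (f r) * cmod (g r)))" by simp
  also have "\<dots> \<le> (LINT r|disk a. t * (cmod (f r))\<^sup>2 + (cmod (g r))\<^sup>2 / t)"
    using i integrable_L2_product[OF f g] by (intro integral_mono b) auto
  also have "\<dots> = t * (l2norm a f)\<^sup>2 + (l2norm a g)\<^sup>2 / t"
    using i by (simp add: l2norm_square)
  also have "\<dots> = 2 * (l2norm a f * l2norm a g)"
    using pos by (simp add: t_def field_simps power2_eq_square)
  finally show ?thesis by simp
qed

lemma l2norm_cong_AE:
  assumes "AE r in disk a. f r = g r" "f \<in> L2 a" "g \<in> L2 a"
  shows "l2norm a f = l2norm a g"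
  unfolding l2norm_def using assms
  by (intro arg_cong[where f = sqrt] integral_cong_AE) (auto simp: L2_def)

lemma l2norm_scale: "l2norm a (\<lambda>r. c * f r) = cmod c * l2norm a f"
  by (simp add: l2norm_def norm_mult power_mult_distrib real_sqrt_mult)

lemma l2norm_triangle:
  assumes "f \<in> L2 a" "g \<in> L2 a"
  shows "l2norm a (\<lambda>r. f r + g r) \<le> l2norm a f + l2norm a g"
proof -
  have sq: "of_real ((l2norm a h)\<^sup>2) = braket a h h" for h by (simp add: braket_self l2norm_square)
  have "complex_of_real ((l2norm a (\<lambda>r. f r + g r))\<^sup>2)
      = of_real ((l2norm a f)\<^sup>2 + (l2norm a g)\<^sup>2) + (braket a f g + cnj (braket a f g))"
    unfolding of_real_add sq using assms by (simp add: braket_linear L2_intros braket_cnj)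
  then have "(l2norm a (\<lambda>r. f r + g r))\<^sup>2 = (l2norm a f)\<^sup>2 + (l2norm a g)\<^sup>2 + 2 * Re (braket a f g)"
    unfolding complex_add_cnj of_real_add[symmetric] of_real_eq_iff by simp
  also have "\<dots> \<le> (l2norm a f)\<^sup>2 + (l2norm a g)\<^sup>2 + 2 * (l2norm a f * l2norm a g)"
    using braket_Cauchy_Schwarz[OF assms] complex_Re_le_cmod[of "braket a f g"] by simp
  also have "\<dots> = (l2norm a f + l2norm a g)\<^sup>2" by (simp add: power2_sum)
  finally show ?thesis by (rule power2_le_imp_le) (simp add: l2norm_nonneg)
qed

subsection \<open>Finite-rank operators and their trace\<close>

text \<open>If $v_n \ne 0$, applying the operator to $v_n$ expresses $u_n$ through the other $u_j$; the
  last term is thereby absorbed in a change of $v_0, \dots, v_{n-1}$ that preserves the sum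
  $\sum_j \langle v_j | u_j\rangle$.\<close>

lemma trace_of_zero_oper:
  fixes n :: nat
  assumes "\<And>j. j < n \<Longrightarrow> u j \<in> L2 a" "\<And>j. j < n \<Longrightarrow> v j \<in> L2 a"
    and "\<And>f. f \<in> L2 a \<Longrightarrow> AE r in disk a. (\<Sum>j<n. u j r * braket a (v j) f) = 0"
  shows "(\<Sum>j<n. braket a (v j) (u j)) = 0"
  using assms
proof (induction n arbitrary: v)
  case 0
  then show ?case by simp
next
  case (Suc n)
  note u = Suc.prems(1) and v = Suc.prems(2)
  show ?case
  proof (cases "l2norm a (v n) = 0")
    case True
    then have z: "f \<in> L2 a \<Longrightarrow> braket a (v n) f = 0" for f
      using AE_zero_if_l2norm_zero braket_eq_0_if_AE_zero v[of n] by blast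
    have "(\<Sum>j<n. braket a (v j) (u j)) = 0"
      by (rule Suc.IH) (use u v Suc.prems(3) z in auto)
    then show ?thesis using z u by simp
  next
    case False
    define N where "N = braket a (v n) (v n)"
    have N: "N \<noteq> 0" using False by (simp add: N_def braket_self l2norm_square[symmetric])
    define c where "c j = braket a (v j) (v n) / N" for j
    \<comment> \<open>The conjugate offsets the conjugate-linear first slot, so that the bra of
      \<open>w j\<close> is the bra of \<open>v j\<close> minus \<open>c j\<close> times the bra of
      \<open>v n\<close>.\<close>
    define w where "w j = (\<lambda>r. v j r - cnj (c j) * v n r)" for j
    have w: "j < n \<Longrightarrow> w j \<in> L2 a" for j unfolding w_def by (intro L2_intros v) auto
    have "AE r in disk a. (\<Sum>j<Suc n. u j r * braket a (v j) (v n)) = 0"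
      by (rule Suc.prems(3)) (use v in auto)
    then have un: "AE r in disk a. u n r = - (\<Sum>j<n. c j * u j r)"
    proof eventually_elim
      case (elim r)
      have "N * (u n r + (\<Sum>j<n. c j * u j r)) = 0"
        using elim N by (simp add: c_def N_def sum_distrib_left algebra_simps)
      then have "u n r + (\<Sum>j<n. c j * u j r) = 0" using N by simp
      then show ?case by (simp add: add_eq_0_iff2)
    qed
    have bw: "braket a (w j) f = braket a (v j) f - c j * braket a (v n) f"
      if "j < n" "f \<in> L2 a" for j f
      unfolding w_def using that v by (simp add: braket_linear L2_intros)
    have "(\<Sum>j<n. braket a (w j) (u j)) = 0"
    proof (rule Suc.IH)
      fix f assume f: "f \<in> L2 a"
      show "AE r in disk a. (\<Sum>j<n. u j r * braket a (w j) f) = 0"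
        using Suc.prems(3)[OF f] un
      proof eventually_elim
        case (elim r)
        have "(\<Sum>j<n. u j r * braket a (w j) f)
            = (\<Sum>j<n. u j r * braket a (v j) f) - (\<Sum>j<n. c j * u j r) * braket a (v n) f"
          by (simp add: bw[OF _ f] sum_distrib_left sum_subtractf right_diff_distrib mult_ac)
        then show ?case using elim by simp
      qed
    qed (use u w in auto)
    then have "(\<Sum>j<n. braket a (v j) (u j)) = (\<Sum>j<n. c j * braket a (v n) (u j))"
      using bw u by (simp add: sum_subtractf)
    moreover have "braket a (v n) (u n) = braket a (v n) (\<lambda>r. - (\<Sum>j<n. c j * u j r))"
      by (rule braket_cong_right[OF un]) (intro L2_intros u v; simp)+
    moreover have "\<dots> = - (\<Sum>j<n. c j * braket a (v n) (u j))"
      unfolding braket_uminus_right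
      by (subst braket_sum_right) (use u v in \<open>auto simp: braket_scale_right intro!: L2_intros\<close>)
    ultimately show ?thesis by simp
  qed
qed

text \<open>Two finite-rank representations of one operator, the second taken with a minus sign on
  its kets and appended to the first, represent zero; the vanishing of the formal trace of zero then
  says that the two candidate traces agree.\<close>

lemma oper_trace_eq:
  assumes "has_oper_trace a A t"
  shows "oper_trace a A = t"
  unfolding oper_trace_def
proof (rule the_equality)
  show "has_oper_trace a A t" by (rule assms)
next
  fix t' assume "has_oper_trace a A t'"
  then obtain n :: nat and u v where 1: "\<forall>j<n. u j \<in> L2 a \<and> v j \<in> L2 a"
     "oper_eq a A (\<lambda>f r. \<Sum>j<n. ketbra a (u j) (v j) f r)" "t' = (\<Sum>j<n. braket a (v j) (u j))"
    unfolding has_oper_trace_def by auto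
  obtain m :: nat and u' v' where 2: "\<forall>j<m. u' j \<in> L2 a \<and> v' j \<in> L2 a"
     "oper_eq a A (\<lambda>f r. \<Sum>j<m. ketbra a (u' j) (v' j) f r)" "t = (\<Sum>j<m. braket a (v' j) (u' j))"
    using assms unfolding has_oper_trace_def by auto
  define U where "U j = (if j < n then u j else (\<lambda>r. - u' (j - n) r))" for j
  define V where "V j = (if j < n then v j else v' (j - n))" for j
  have split: "(\<Sum>j<n + m. F j) = (\<Sum>j<n. F j) + (\<Sum>j<m. F (n + j))" for F :: "nat \<Rightarrow> complex"
    by (induction m) (auto simp: add.assoc)
  have "(\<Sum>j<n + m. braket a (V j) (U j)) = 0"
  proof (rule trace_of_zero_oper)
    fix f assume f: "f \<in> L2 a"
    have "AE r in disk a. A f r = (\<Sum>j<n. ketbra a (u j) (v j) f r)"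
      "AE r in disk a. A f r = (\<Sum>j<m. ketbra a (u' j) (v' j) f r)"
      using 1(2) 2(2) f by (auto simp: oper_eq_def)
    then show "AE r in disk a. (\<Sum>j<n + m. U j r * braket a (V j) f) = 0"
      by eventually_elim (simp add: split U_def V_def ketbra_def sum_negf)
  qed (use 1(1) 2(1) in \<open>auto simp: U_def V_def intro!: L2_uminus\<close>)
  then show "t' = t"
    unfolding split using 1(3) 2(3) by (simp add: U_def V_def sum_negf braket_uminus_right)
qed

lemma bounded_operD:
  assumes "bounded_oper a A"
  shows "f \<in> L2 a \<Longrightarrow> A f \<in> L2 a"
    "f \<in> L2 a \<Longrightarrow> g \<in> L2 a \<Longrightarrow> AE r in disk a. A (\<lambda>x. c * f x + g x) r = c * A f r + A g r"
    "\<exists>C. \<forall>f\<in>L2 a. l2norm a (A f) \<le> C * l2norm a f"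
  using assms unfolding bounded_oper_def by blast+

text \<open>An operator is a map on functions, not on classes modulo null sets, so compatibility
  with equality almost everywhere has to be derived. It follows from boundedness, because the
  difference of the arguments has norm zero.\<close>

lemma bounded_oper_cong_AE:
  assumes A: "bounded_oper a A" and f: "f \<in> L2 a" and g: "g \<in> L2 a" and "AE r in disk a. f r = g r"
  shows "AE r in disk a. A f r = A g r"
proof -
  obtain C where C: "\<forall>f\<in>L2 a. l2norm a (A f) \<le> C * l2norm a f" using bounded_operD(3)[OF A] by blast
  define d where "d = (\<lambda>r. (-1) * f r + g r)"
  have d: "d \<in> L2 a" unfolding d_def by (intro L2_intros f g)
  have "l2norm a d = l2norm a (\<lambda>r. 0)"
    by (rule l2norm_cong_AE[OF _ d L2_zero]) (use assms(4) in \<open>eventually_elim, simp add: d_def\<close>)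
  then have "l2norm a (A d) \<le> 0" using C d by (auto simp: l2norm_def)
  then have "AE r in disk a. A d r = 0"
    using l2norm_nonneg[of a "A d"] bounded_operD(1)[OF A d] by (intro AE_zero_if_l2norm_zero) auto
  moreover have "AE r in disk a. A d r = (-1) * A f r + A g r"
    unfolding d_def by (rule bounded_operD(2)[OF A f g])
  ultimately show ?thesis by eventually_elim simp
qed

text \<open>Operators are only linear almost everywhere, even at the zero vector.\<close>

lemma bounded_oper_comb2:
  assumes A: "bounded_oper a A" and f: "f \<in> L2 a" and g: "g \<in> L2 a"
  shows "AE r in disk a. A (\<lambda>x. f x * c + g x * d) r = A f r * c + A g r * d"
proof -
  have "AE r in disk a. A (\<lambda>x. c * f x + d * g x) r = c * A f r + A (\<lambda>x. d * g x) r"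
    by (intro bounded_operD(2)[OF A] L2_intros f g)
  moreover have "AE r in disk a. A (\<lambda>x. d * g x + 0) r = d * A g r + A (\<lambda>x. 0) r"
    by (rule bounded_operD(2)[OF A g L2_zero])
  moreover have "AE r in disk a. A (\<lambda>x. 1 * 0 + 0) r = 1 * A (\<lambda>x. 0) r + A (\<lambda>x. 0) r"
    by (rule bounded_operD(2)[OF A L2_zero L2_zero])
  ultimately show ?thesis by eventually_elim (simp add: mult.commute)
qed

lemma bounded_oper_ketbra:
  assumes u: "u \<in> L2 a" and v: "v \<in> L2 a"
  shows "bounded_oper a (ketbra a u v)"
  unfolding bounded_oper_def
proof (intro conjI ballI allI)
  show "ketbra a u v f \<in> L2 a" for f unfolding ketbra_def by (intro L2_intros u)
  show "AE r in disk a. ketbra a u v (\<lambda>x. c * f x + g x) r = c * ketbra a u v f r + ketbra a u v g r"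
    if "f \<in> L2 a" "g \<in> L2 a" for f g c
    unfolding ketbra_def using that v by (simp add: braket_linear L2_intros algebra_simps)
  have "l2norm a (ketbra a u v f) \<le> (l2norm a u * l2norm a v) * l2norm a f" if f: "f \<in> L2 a" for f
  proof -
    have "l2norm a (ketbra a u v f) = cmod (braket a v f) * l2norm a u"
      using l2norm_scale[of a "braket a v f" u] by (simp add: ketbra_def mult.commute)
    also have "\<dots> \<le> (l2norm a v * l2norm a f) * l2norm a u"
      by (intro mult_right_mono braket_Cauchy_Schwarz v f l2norm_nonneg)
    finally show ?thesis by (simp add: algebra_simps)
  qed
  then show "\<exists>C. \<forall>f\<in>L2 a. l2norm a (ketbra a u v f) \<le> C * l2norm a f" by blast
qed

lemma bounded_oper_add:
  assumes A: "bounded_oper a A" and B: "bounded_oper a B"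
  shows "bounded_oper a (\<lambda>f r. A f r + B f r)"
  unfolding bounded_oper_def
proof (intro conjI ballI allI)
  show "f \<in> L2 a \<Longrightarrow> (\<lambda>r. A f r + B f r) \<in> L2 a" for f
    by (intro L2_add bounded_operD(1)[OF A] bounded_operD(1)[OF B])
  show "AE r in disk a. A (\<lambda>x. c * f x + g x) r + B (\<lambda>x. c * f x + g x) r
      = c * (A f r + B f r) + (A g r + B g r)" if "f \<in> L2 a" "g \<in> L2 a" for f g c
    using bounded_operD(2)[OF A that, of c] bounded_operD(2)[OF B that, of c]
    by eventually_elim (simp add: algebra_simps)
  obtain C D where "\<forall>f\<in>L2 a. l2norm a (A f) \<le> C * l2norm a f" "\<forall>f\<in>L2 a. l2norm a (B f) \<le> D * l2norm a f"
    using bounded_operD(3)[OF A] bounded_operD(3)[OF B] by blast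
  then have "l2norm a (\<lambda>r. A f r + B f r) \<le> (C + D) * l2norm a f" if "f \<in> L2 a" for f
    using that l2norm_triangle[OF bounded_operD(1)[OF A that] bounded_operD(1)[OF B that]]
    unfolding distrib_right by (meson add_mono order_trans)
  then show "\<exists>C. \<forall>f\<in>L2 a. l2norm a (\<lambda>r. A f r + B f r) \<le> C * l2norm a f" by blast
qed

lemma bounded_oper_scale:
  assumes A: "bounded_oper a A"
  shows "bounded_oper a (\<lambda>f r. c * A f r)"
  unfolding bounded_oper_def
proof (intro conjI ballI allI)
  show "f \<in> L2 a \<Longrightarrow> (\<lambda>r. c * A f r) \<in> L2 a" for f by (intro L2_scale bounded_operD(1)[OF A])
  show "AE r in disk a. c * A (\<lambda>x. d * f x + g x) r = d * (c * A f r) + c * A g r"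
    if "f \<in> L2 a" "g \<in> L2 a" for f g d
    using bounded_operD(2)[OF A that, of d] by eventually_elim (simp add: algebra_simps)
  obtain C where "\<forall>f\<in>L2 a. l2norm a (A f) \<le> C * l2norm a f" using bounded_operD(3)[OF A] by blast
  then have "\<forall>f\<in>L2 a. l2norm a (\<lambda>r. c * A f r) \<le> (cmod c * C) * l2norm a f"
    by (auto simp: l2norm_scale mult.assoc intro!: mult_left_mono)
  then show "\<exists>C. \<forall>f\<in>L2 a. l2norm a (\<lambda>r. c * A f r) \<le> C * l2norm a f" by blast
qed

lemma bounded_oper_id: "bounded_oper a (\<lambda>f. f)"
  unfolding bounded_oper_def by (auto intro!: exI[of _ 1])

lemma bounded_oper_diff:
  "bounded_oper a A \<Longrightarrow> bounded_oper a B \<Longrightarrow> bounded_oper a (\<lambda>f r. A f r - B f r)"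
  using bounded_oper_add[OF _ bounded_oper_scale[of a B "-1"], of A] by simp

lemma selfadjoint_operD:
  "selfadjoint_oper a A \<Longrightarrow> f \<in> L2 a \<Longrightarrow> g \<in> L2 a \<Longrightarrow> braket a (A f) g = braket a f (A g)"
  by (simp add: selfadjoint_oper_def)

lemma selfadjoint_oper_ketbra_sym:
  assumes "u \<in> L2 a" "v \<in> L2 a"
  shows "selfadjoint_oper a (\<lambda>f r. ketbra a u v f r + ketbra a v u f r)"
  unfolding selfadjoint_oper_def ketbra_def using assms
  by (auto simp: braket_linear L2_intros braket_cnj mult.commute add.commute)

lemma selfadjoint_oper_ketbra: "u \<in> L2 a \<Longrightarrow> selfadjoint_oper a (ketbra a u u)"
  unfolding selfadjoint_oper_def ketbra_def
  by (auto simp: braket_linear L2_intros braket_cnj mult.commute)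

lemma selfadjoint_oper_add:
  assumes "bounded_oper a A" "bounded_oper a B" "selfadjoint_oper a A" "selfadjoint_oper a B"
  shows "selfadjoint_oper a (\<lambda>f r. A f r + B f r)"
  using assms unfolding selfadjoint_oper_def by (auto simp: braket_linear bounded_operD(1))

lemma selfadjoint_oper_diff:
  assumes "bounded_oper a A" "bounded_oper a B" "selfadjoint_oper a A" "selfadjoint_oper a B"
  shows "selfadjoint_oper a (\<lambda>f r. A f r - B f r)"
  using assms unfolding selfadjoint_oper_def by (auto simp: braket_linear bounded_operD(1))

lemma selfadjoint_oper_id: "selfadjoint_oper a (\<lambda>f. f)"
  by (simp add: selfadjoint_oper_def)

subsection \<open>Integrals over the disk\<close>

text \<open>Integration over the disk is defined through the completed Lebesgue measure; changes of
  variables and Fubini are applied to \<open>lborel\<close>, and this is the passage between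
  them.\<close>

lemma integral_disk_lborel:
  fixes f :: "real \<times> real \<Rightarrow> real"
  assumes "f \<in> borel_measurable borel"
  shows "(LINT r|disk a. f r) = (LINT r|lborel. indicator (cball 0 a) r * f r)"
proof -
  have "(LINT r|disk a. f r) = (LINT r|lebesgue. indicator (cball 0 a) r * f r)"
    unfolding disk_def by (subst integral_restrict_space) auto
  also have "\<dots> = (LINT r|lborel. indicator (cball 0 a) r * f r)"
    by (rule integral_completion) (use assms in \<open>auto intro!: borel_measurable_times borel_measurable_indicator\<close>)
  finally show ?thesis .
qed

text \<open>A diagonal linear map whose entries have modulus 1 has Jacobian 1.\<close>

lemma lborel_reflect:
  fixes c1 c2 :: real
  assumes "\<bar>c1\<bar> = 1" "\<bar>c2\<bar> = 1"
  shows "distr lborel borel (\<lambda>x :: real \<times> real. (c1 * fst x, c2 * snd x)) = lborel"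
proof -
  define c :: "real \<times> real \<Rightarrow> real" where "c j = (if j = (1, 0) then c1 else c2)" for j
  have B: "(Basis :: (real \<times> real) set) = {(1, 0), (0, 1)}"
    by (auto simp: Basis_prod_def)
  have "lborel = density (distr lborel borel (\<lambda>x :: real \<times> real. 0 + (\<Sum>j\<in>Basis. (c j * (x \<bullet> j)) *\<^sub>R j)))
       (\<lambda>_. (\<Prod>j\<in>Basis. \<bar>c j\<bar>))"
    by (rule lborel_affine_euclidean) (use assms in \<open>auto simp: c_def\<close>)
  moreover have "(\<Prod>j\<in>Basis. \<bar>c j\<bar>) = 1" using assms by (auto simp: B c_def)
  moreover have "(\<lambda>x :: real \<times> real. 0 + (\<Sum>j\<in>Basis. (c j * (x \<bullet> j)) *\<^sub>R j)) = (\<lambda>x. (c1 * fst x, c2 * snd x))"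
    by (auto simp: B c_def inner_prod_def fun_eq_iff)
  ultimately show ?thesis by (simp add: density_1)
qed

lemma integral_disk_reflect:
  fixes f :: "real \<times> real \<Rightarrow> real"
  assumes f: "continuous_on UNIV f" and c: "\<bar>c1\<bar> = 1" "\<bar>c2\<bar> = 1"
  shows "(LINT r|disk a. f (c1 * fst r, c2 * snd r)) = (LINT r|disk a. f r)"
proof -
  have [measurable]: "f \<in> borel_measurable borel" by (rule borel_measurable_continuous_onI[OF f])
  have [measurable]: "(\<lambda>r :: real \<times> real. (c1 * fst r, c2 * snd r)) \<in> borel_measurable borel"
    by (intro borel_measurable_continuous_onI continuous_intros)
  have sq: "c1\<^sup>2 = 1" "c2\<^sup>2 = 1" using c by (metis power2_abs power_one)+
  have n: "(c1 * fst r, c2 * snd r) \<in> cball 0 a \<longleftrightarrow> r \<in> cball 0 a" for r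
    by (cases r) (simp add: norm_Pair power_mult_distrib sq)
  have "(LINT r|disk a. f r) = (LINT r|lborel. indicator (cball 0 a) r * f r)"
    by (rule integral_disk_lborel) measurable
  also have "\<dots> = (LINT r|distr lborel borel (\<lambda>x :: real \<times> real. (c1 * fst x, c2 * snd x)). indicator (cball 0 a) r * f r)"
    by (simp only: lborel_reflect[OF c])
  also have "\<dots> = (LINT r|lborel. indicator (cball 0 a) (c1 * fst r, c2 * snd r) * f (c1 * fst r, c2 * snd r))"
    by (rule integral_distr) (auto intro!: borel_measurable_times borel_measurable_indicator)
  also have "\<dots> = (LINT r|lborel. indicator (cball 0 a) r * f (c1 * fst r, c2 * snd r))"
    by (simp only: indicator_def n)
  also have "\<dots> = (LINT r|disk a. f (c1 * fst r, c2 * snd r))"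
    by (rule integral_disk_lborel[symmetric]) measurable
  finally show ?thesis by simp
qed

text \<open>This replaces integration in polar coordinates: the zero means of the two tilts and all
  mutual orthogonalities of the three Zernike functions follow from reflections in the coordinate
  axes.\<close>

lemma integral_disk_odd:
  fixes f :: "real \<times> real \<Rightarrow> real"
  assumes "continuous_on UNIV f" "\<bar>c1\<bar> = 1" "\<bar>c2\<bar> = 1" "\<And>r. f (c1 * fst r, c2 * snd r) = - f r"
  shows "(LINT r|disk a. f r) = 0"
  using integral_disk_reflect[OF assms(1-3), of a] assms(4) by simp

lemma emeasure_cball_plane:
  "x \<ge> 0 \<Longrightarrow> emeasure lborel (cball (0 :: real \<times> real) x) = ennreal (pi * x\<^sup>2)"
  by (simp add: emeasure_cball unit_ball_vol_2 power2_eq_square)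

lemma integral_disk_const:
  assumes "a > 0"
  shows "(LINT r|disk a. c) = pi * a\<^sup>2 * (c :: real)"
proof -
  have "measure (disk a) (space (disk a)) = measure lborel (cball (0 :: real \<times> real) a)"
    unfolding space_disk unfolding disk_def
    by (subst measure_restrict_space) auto
  also have "\<dots> = pi * a\<^sup>2" using assms by (simp add: measure_def emeasure_cball_plane)
  finally show ?thesis by simp
qed

text \<open>Layer cake: $a^2 - |r|^2$ is the length of the set of $t \le a^2$ with $|r|^2 \le t$, and for
  fixed $t$ these $r$ form a disk of area $\pi t$.\<close>

lemma integral_disk_norm_square:
  assumes a: "a > 0"
  shows "(LINT r|disk a. (norm r)\<^sup>2) = pi * a^4 / 2"
proof -
  define G :: "real \<times> real \<Rightarrow> real \<Rightarrow> ennreal"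
    where "G r t = indicator {x. (norm (fst x))\<^sup>2 \<le> snd x \<and> snd x \<le> a\<^sup>2} (r, t)" for r t
  have closed: "closed {x :: (real \<times> real) \<times> real. (norm (fst x))\<^sup>2 \<le> snd x \<and> snd x \<le> a\<^sup>2}"
    by (intro closed_Collect_conj closed_Collect_le continuous_intros)
  have G: "case_prod G \<in> borel_measurable (lborel \<Otimes>\<^sub>M lborel)"
    unfolding G_def lborel_prod using closed
    by (simp add: split_def)
  have r_in: "r \<in> cball 0 a \<longleftrightarrow> (norm r)\<^sup>2 \<le> a\<^sup>2" for r :: "real \<times> real"
    using a by (simp add: abs_le_square_iff[symmetric])
  have inner_t: "(\<integral>\<^sup>+t. G r t \<partial>lborel) = ennreal (indicator (cball 0 a) r * (a\<^sup>2 - (norm r)\<^sup>2))" for r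
  proof -
    have "(\<integral>\<^sup>+t. G r t \<partial>lborel) = (\<integral>\<^sup>+t. indicator {(norm r)\<^sup>2..a\<^sup>2} t \<partial>lborel)"
      by (intro nn_integral_cong) (auto simp: G_def indicator_def)
    also have "\<dots> = emeasure lborel {(norm r)\<^sup>2..a\<^sup>2}" by simp
    also have "\<dots> = ennreal (indicator (cball 0 a) r * (a\<^sup>2 - (norm r)\<^sup>2))"
      using r_in[of r] by (auto simp: indicator_def emeasure_lborel_Icc_eq)
    finally show ?thesis .
  qed
  have inner_r: "(\<integral>\<^sup>+r. G r t \<partial>lborel) = ennreal (pi * t) * indicator {0..a\<^sup>2} t" for t
  proof (cases "t \<in> {0..a\<^sup>2}")
    case True
    have "(norm r)\<^sup>2 \<le> t \<longleftrightarrow> r \<in> cball 0 (sqrt t)" for r :: "real \<times> real"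
      using True by (simp add: real_le_rsqrt real_sqrt_le_iff[symmetric, of "(norm r)\<^sup>2"] del: real_sqrt_le_iff)
    then have "(\<integral>\<^sup>+r. G r t \<partial>lborel) = (\<integral>\<^sup>+r. indicator (cball (0 :: real \<times> real) (sqrt t)) r \<partial>lborel)"
      using True by (intro nn_integral_cong) (auto simp: G_def indicator_def)
    also have "\<dots> = emeasure lborel (cball (0 :: real \<times> real) (sqrt t))" by simp
    also have "\<dots> = ennreal (pi * t)" using True by (simp add: emeasure_cball_plane)
    finally show ?thesis using True by simp
  next
    case False
    have "G r t = 0" for r
      using False order_trans[of 0 "(norm r)\<^sup>2" t] by (auto simp: G_def indicator_def)
    then show ?thesis using False by simp
  qed
  have "(\<integral>\<^sup>+r. ennreal (indicator (cball 0 a) r * (a\<^sup>2 - (norm (r :: real \<times> real))\<^sup>2)) \<partial>lborel) = (\<integral>\<^sup>+t. \<integral>\<^sup>+r. G r t \<partial>lborel \<partial>lborel)"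
    unfolding inner_t[symmetric] by (rule lborel_pair.Fubini'[OF G, symmetric])
  also have "\<dots> = (\<integral>\<^sup>+t. ennreal (pi * t) * indicator {0..a\<^sup>2} t \<partial>lborel)" by (simp only: inner_r)
  also have "\<dots> = ennreal (pi * (a\<^sup>2)\<^sup>2 / 2 - pi * 0\<^sup>2 / 2)"
    by (rule nn_integral_FTC_Icc) (auto intro!: derivative_eq_intros)
  finally have "(LINT r|lborel. indicator (cball 0 a) r * (a\<^sup>2 - (norm (r :: real \<times> real))\<^sup>2)) = pi * a^4 / 2"
    by (intro integral_eq_nn_integral[THEN trans]) (auto simp: indicator_def power_mult[symmetric] intro!: AE_I2 power_mono)
  then have "(LINT r|disk a. a\<^sup>2 - (norm r)\<^sup>2) = pi * a^4 / 2"
    by (subst integral_disk_lborel) auto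
  moreover have "(LINT r|disk a. a\<^sup>2 - (norm r)\<^sup>2) = (LINT r|disk a. a\<^sup>2) - (LINT r|disk a. (norm r)\<^sup>2)"
    by (intro Bochner_Integration.integral_diff integrable_disk_continuous continuous_intros)
  moreover have "(LINT r|disk a. a\<^sup>2) = pi * a^4"
    unfolding integral_disk_const[OF a] by (simp add: power2_eq_square power4_eq_xxxx)
  ultimately show ?thesis by linarith
qed

text \<open>The function vanishes almost everywhere on the disk, and a nonzero value at an interior
  point would persist on a nonempty open subset, which is not negligible.\<close>

lemma zero_if_integral_disk_square_zero:
  fixes f :: "real \<times> real \<Rightarrow> real"
  assumes f: "continuous_on UNIV f" and z: "(LINT r|disk a. (f r)\<^sup>2) = 0" and r: "r \<in> ball 0 a"
  shows "f r = 0"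
proof (rule ccontr)
  assume nz: "f r \<noteq> 0"
  have "AE r in disk a. (f r)\<^sup>2 = 0"
    using z by (subst (asm) integral_nonneg_eq_0_iff_AE)
      (auto intro!: integrable_disk_continuous continuous_intros f)
  then have "AE r in lebesgue. r \<in> cball 0 a \<longrightarrow> f r = 0"
    unfolding disk_def by (subst (asm) AE_restrict_space_iff) auto
  then have "negligible {r. \<not> (r \<in> cball 0 a \<longrightarrow> f r = 0)}"
    by (simp add: negligible_iff_null_sets eventually_ae_filter)
       (metis (no_types, lifting) completion.complete2)
  moreover have "{r \<in> ball 0 a. f r \<noteq> 0} \<subseteq> {r. \<not> (r \<in> cball 0 a \<longrightarrow> f r = 0)}" by auto
  ultimately have "negligible {r \<in> ball 0 a. f r \<noteq> 0}" using negligible_subset by blast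
  moreover have "open {r \<in> ball 0 a. f r \<noteq> 0}"
    unfolding Collect_conj_eq Collect_mem_eq by (intro open_Int open_ball open_Collect_neq f continuous_intros)
  ultimately show False using open_not_negligible[of "{r \<in> ball 0 a. f r \<noteq> 0}"] r nz by blast
qed

subsection \<open>Differentiation of oscillatory integrals\<close>

text \<open>Taylor's formula leaves f''(t) h^2 / 2, and the factor 1/2 is given away. The bound is
  uniform in x, so with x the phase at a point (or the difference of two phases) it can be
  integrated over the disk.\<close>

lemma second_order_bound:
  fixes f f' f'' :: "real \<Rightarrow> real"
  assumes "\<And>x. (f has_real_derivative f' x) (at x)" "\<And>x. (f' has_real_derivative f'' x) (at x)"
    and b: "\<And>x. \<bar>f'' x\<bar> \<le> 1"
  shows "\<bar>f (x + h) - f x - h * f' x\<bar> \<le> h\<^sup>2"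
proof (cases "h = 0")
  case False
  define diff where "diff m = (if m = 0 then f else if m = 1 then f' else f'')" for m :: nat
  have "\<exists>t. (if x + h < x then x + h < t \<and> t < x else x < t \<and> t < x + h) \<and>
    f (x + h) = (\<Sum>m<2. (diff m x / fact m) * (x + h - x)^m) + (diff 2 t / fact 2) * (x + h - x)^2"
    by (rule Taylor[where a = "x - \<bar>h\<bar>" and b = "x + \<bar>h\<bar>"])
       (use False assms in \<open>auto simp: diff_def less_2_cases_iff\<close>)
  then obtain t where "f (x + h) = (\<Sum>m<2. (diff m x / fact m) * (x + h - x)^m) + (diff 2 t / fact 2) * (x + h - x)^2"
    by blast
  then have "f (x + h) - f x - h * f' x = (f'' t / 2) * h\<^sup>2"
    by (simp add: diff_def numeral_2_eq_2)
  moreover have "\<bar>(f'' t / 2) * h\<^sup>2\<bar> \<le> 1 * h\<^sup>2"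
    unfolding abs_mult by (intro mult_mono) (use b[of t] in auto)
  ultimately show ?thesis by simp
qed simp

text \<open>A quantitative estimate takes the place of dominated convergence: the pointwise
  second-order bound integrates to an error of at most K h^2, with K the integral of |w|
  g^2.\<close>

lemma has_real_derivative_integral_disk:
  fixes w \<theta> g :: "real \<times> real \<Rightarrow> real"
  assumes cont: "continuous_on UNIV w" "continuous_on UNIV \<theta>" "continuous_on UNIV g"
    and f: "\<And>x. (f has_real_derivative f' x) (at x)" and f': "\<And>x. (f' has_real_derivative f'' x) (at x)"
    and b: "\<And>x. \<bar>f'' x\<bar> \<le> 1"
  shows "((\<lambda>t. LINT r|disk a. w r * f (\<theta> r + t * g r)) has_real_derivative
      (LINT r|disk a. (w r * g r) * f' (\<theta> r + t * g r))) (at t)"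
proof -
  have cf: "continuous_on UNIV f" "continuous_on UNIV f'"
    using f f' by (auto intro!: continuous_at_imp_continuous_on DERIV_isCont)
  have cc: "continuous_on UNIV (\<lambda>r. f (\<theta> r + u * g r))" "continuous_on UNIV (\<lambda>r. f' (\<theta> r + u * g r))" for u
    by (rule continuous_on_compose2[OF cf(1)] continuous_on_compose2[OF cf(2)]; intro continuous_intros cont subset_UNIV)+
  define F where "F u = (LINT r|disk a. w r * f (\<theta> r + u * g r))" for u
  define D where "D = (LINT r|disk a. (w r * g r) * f' (\<theta> r + t * g r))"
  define K where "K = (LINT r|disk a. \<bar>w r\<bar> * (g r)\<^sup>2)"
  have est: "\<bar>F (t + h) - F t - h * D\<bar> \<le> K * h\<^sup>2" for h
  proof -
    have i: "integrable (disk a) (\<lambda>r. w r * f (\<theta> r + (t + h) * g r))"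
      "integrable (disk a) (\<lambda>r. w r * f (\<theta> r + t * g r))"
      "integrable (disk a) (\<lambda>r. h * ((w r * g r) * f' (\<theta> r + t * g r)))"
      "integrable (disk a) (\<lambda>r. h\<^sup>2 * (\<bar>w r\<bar> * (g r)\<^sup>2))"
      by (intro integrable_disk_continuous continuous_intros cont cc)+
    define E where "E r = w r * f (\<theta> r + (t + h) * g r) - w r * f (\<theta> r + t * g r)
        - h * ((w r * g r) * f' (\<theta> r + t * g r))" for r
    have iE: "integrable (disk a) E" unfolding E_def using i by auto
    have "F (t + h) - F t - h * D = (LINT r|disk a. E r)"
      unfolding F_def D_def E_def using i by simp
    also have "\<bar>\<dots>\<bar> \<le> (LINT r|disk a. \<bar>E r\<bar>)"
      by (rule integral_abs_bound)
    also have "\<dots> \<le> (LINT r|disk a. h\<^sup>2 * (\<bar>w r\<bar> * (g r)\<^sup>2))"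
    proof (rule integral_mono)
      fix r
      have "E r = w r * (f ((\<theta> r + t * g r) + h * g r) - f (\<theta> r + t * g r) - (h * g r) * f' (\<theta> r + t * g r))"
        by (simp add: E_def algebra_simps)
      then have "\<bar>E r\<bar> \<le> \<bar>w r\<bar> * (h * g r)\<^sup>2"
        by (simp add: abs_mult) (intro mult_left_mono second_order_bound[OF f f' b] abs_ge_zero)
      then show "\<bar>E r\<bar> \<le> h\<^sup>2 * (\<bar>w r\<bar> * (g r)\<^sup>2)" by (simp add: power_mult_distrib mult_ac)
    qed (use iE i in auto)
    finally show ?thesis by (simp add: K_def mult.commute)
  qed
  have "((\<lambda>h. (F (t + h) - F t) / h - D) \<longlongrightarrow> 0) (at 0)"
  proof (rule Lim_null_comparison)
    show "\<forall>\<^sub>F h in at 0. norm ((F (t + h) - F t) / h - D) \<le> K * \<bar>h\<bar>"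
    proof (rule eventually_at_ball'[of 1, THEN eventually_mono])
      fix h :: real assume h: "h \<in> ball 0 1 \<and> h \<noteq> 0 \<and> h \<in> UNIV"
      then have "(F (t + h) - F t) / h - D = (F (t + h) - F t - h * D) / h" by (simp add: field_simps)
      then have "norm ((F (t + h) - F t) / h - D) = \<bar>F (t + h) - F t - h * D\<bar> / \<bar>h\<bar>" by simp
      also have "\<dots> \<le> K * h\<^sup>2 / \<bar>h\<bar>" by (intro divide_right_mono est) simp
      also have "\<dots> = K * \<bar>h\<bar>" using h by (simp add: field_simps power2_eq_square flip: abs_mult)
      finally show "norm ((F (t + h) - F t) / h - D) \<le> K * \<bar>h\<bar>" .
    qed simp
    show "((\<lambda>h. K * \<bar>h\<bar>) \<longlongrightarrow> 0) (at 0)" by (auto intro!: tendsto_eq_intros)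
  qed
  then have "((\<lambda>h. (F (t + h) - F t) / h) \<longlongrightarrow> D) (at 0)" by (simp add: LIM_zero_iff)
  then show ?thesis unfolding F_def D_def by (simp add: DERIV_def)
qed

subsection \<open>The state in terms of two real waves\<close>

text \<open>The real exponent of \<open>Phi\<close>. It is linear in s, so its derivative along v is
  the phase of v itself; in particular the partial derivative in direction i is
  \<open>phase k (axis i 1)\<close>, independent of s.\<close>

definition phase :: "real \<Rightarrow> real^3 \<Rightarrow> real \<times> real \<Rightarrow> real" where
  "phase k s r = k * (s$1 * fst r + s$2 * snd r - s$3 * (norm r)\<^sup>2 / 2)"

definition cos_wave :: "real \<Rightarrow> real \<Rightarrow> real^3 \<Rightarrow> real \<times> real \<Rightarrow> real" where
  "cos_wave a k s r = 1 / (sqrt pi * a) * cos (phase k s r)"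

definition sin_wave :: "real \<Rightarrow> real \<Rightarrow> real^3 \<Rightarrow> real \<times> real \<Rightarrow> real" where
  "sin_wave a k s r = 1 / (sqrt pi * a) * sin (phase k s r)"

text \<open>Real waves stay real functions and are embedded only where operators act on them, so
  that their inner products are real integrals.\<close>

definition rwave :: "(real \<times> real \<Rightarrow> real) \<Rightarrow> wave" where
  "rwave w = (\<lambda>r. complex_of_real (w r))"

lemma continuous_phase: "continuous_on UNIV (phase k s)"
  unfolding phase_def[abs_def] by (intro continuous_intros) simp

lemma continuous_cos_wave: "continuous_on UNIV (cos_wave a k s)"
  unfolding cos_wave_def[abs_def] by (intro continuous_intros continuous_phase)

lemma continuous_sin_wave: "continuous_on UNIV (sin_wave a k s)"
  unfolding sin_wave_def[abs_def] by (intro continuous_intros continuous_phase)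

lemma rwave_L2: "continuous_on UNIV w \<Longrightarrow> rwave w \<in> L2 a"
  unfolding rwave_def by (intro L2_continuous continuous_intros)

lemma cos_wave_L2: "rwave (cos_wave a k s) \<in> L2 b"
  and sin_wave_L2: "rwave (sin_wave a k s) \<in> L2 b"
  by (intro rwave_L2 continuous_cos_wave continuous_sin_wave)+

lemma phase_add_scale: "phase k (s + t *\<^sub>R v) r = phase k s r + t * phase k v r"
  by (simp add: phase_def algebra_simps diff_divide_distrib add_divide_distrib)

lemma phase_scale: "phase k (t *\<^sub>R v) r = t * phase k v r"
  using phase_add_scale[of k 0 t v r] by (simp add: phase_def)

lemma phase_uminus: "phase k (- s) r = - phase k s r"
  using phase_scale[of k "-1" s r] by simp

lemma braket_rwave: "braket a (rwave u) (rwave w) = of_real (LINT r|disk a. u r * w r)"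
  unfolding braket_def rwave_def by (simp flip: of_real_mult)

lemma Phi_rwave:
  "Phi a k s = (\<lambda>r. rwave (cos_wave a k s) r + \<i> * rwave (sin_wave a k s) r)"
proof
  fix r
  have "exp (\<i> * complex_of_real (phase k s r)) = cos (phase k s r) + \<i> * sin (phase k s r)"
    by (simp add: cis_conv_exp[symmetric] complex_eq_iff)
  then show "Phi a k s r = rwave (cos_wave a k s) r + \<i> * rwave (sin_wave a k s) r"
    unfolding Phi_def phase_def[symmetric]
    by (simp only: rwave_def cos_wave_def sin_wave_def of_real_mult distrib_left mult_ac)
qed

lemma cos_wave_uminus: "cos_wave a k (- s) = cos_wave a k s"
  and sin_wave_uminus: "sin_wave a k (- s) = (\<lambda>r. - sin_wave a k s r)"
  by (auto simp: cos_wave_def sin_wave_def phase_uminus)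

lemma Phi_uminus_rwave:
  "Phi a k (- s) = (\<lambda>r. rwave (cos_wave a k s) r - \<i> * rwave (sin_wave a k s) r)"
  unfolding Phi_rwave cos_wave_uminus sin_wave_uminus by (simp add: rwave_def)

lemma Phi_L2: "Phi a k s \<in> L2 b"
  unfolding Phi_rwave by (intro L2_intros cos_wave_L2 sin_wave_L2)

text \<open>The mixed terms in C and S have opposite signs for the sources at s and -s and cancel in
  the equal mixture.\<close>

lemma rho_rwave:
  assumes f: "f \<in> L2 a"
  shows "rho a k s f r = rwave (cos_wave a k s) r * braket a (rwave (cos_wave a k s)) f
    + rwave (sin_wave a k s) r * braket a (rwave (sin_wave a k s)) f"
proof -
  let ?c = "rwave (cos_wave a k s)" and ?s = "rwave (sin_wave a k s)"
  have "braket a (Phi a k s) f = braket a ?c f - \<i> * braket a ?s f"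
    unfolding Phi_rwave using f by (simp add: braket_linear L2_intros cos_wave_L2 sin_wave_L2)
  moreover have "braket a (Phi a k (- s)) f = braket a ?c f + \<i> * braket a ?s f"
    unfolding Phi_uminus_rwave using f by (simp add: braket_linear L2_intros cos_wave_L2 sin_wave_L2)
  moreover have "Phi a k s r = ?c r + \<i> * ?s r" "Phi a k (- s) r = ?c r - \<i> * ?s r"
    unfolding Phi_uminus_rwave unfolding Phi_rwave by simp_all
  ultimately show ?thesis
    by (simp only: rho_def ketbra_def) (simp add: field_simps)
qed

lemma bounded_oper_rho: "bounded_oper a (rho a k s)"
  unfolding rho_def by (intro bounded_oper_add bounded_oper_scale bounded_oper_ketbra Phi_L2)

text \<open>The addition theorem for the cosine merges the two rank-one terms into one kernel. A
  shift of s then enters only through the argument of a cosine, which makes difference quotients of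
  the state accessible to a pointwise estimate.\<close>

lemma rho_kernel:
  assumes f: "f \<in> L2 a"
  shows "rho a k s f r
    = braket a (rwave (\<lambda>r'. (1 / (sqrt pi * a))\<^sup>2 * cos (phase k s r - phase k s r'))) f"
proof -
  define N where "N = 1 / (sqrt pi * a)"
  have w: "cos_wave a k s x = N * cos (phase k s x)" "sin_wave a k s x = N * sin (phase k s x)" for x
    by (simp_all add: cos_wave_def sin_wave_def N_def)
  have "rwave (\<lambda>r'. (1 / (sqrt pi * a))\<^sup>2 * cos (phase k s r - phase k s r'))
     = (\<lambda>r'. of_real (cos_wave a k s r) * rwave (cos_wave a k s) r' + of_real (sin_wave a k s r) * rwave (sin_wave a k s) r')"
    unfolding rwave_def of_real_mult[symmetric] of_real_add[symmetric] w N_def[symmetric]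
    by (rule ext, rule arg_cong[where f = of_real]) (simp add: cos_diff power2_eq_square algebra_simps)
  then show ?thesis
    unfolding rho_rwave[OF f] using f
    by (simp add: braket_linear L2_intros cos_wave_L2 sin_wave_L2) (simp add: rwave_def)
qed

text \<open>Here \<open>B\<close> is the adjoint of \<open>A\<close>: composing a bra with
  \<open>A\<close> gives the bra of the image under \<open>B\<close>, so the composition is already
  written as a sum of two ket-bras. For a product such as L_i P L_j of self-adjoint factors,
  \<open>B\<close> is the product in reverse order.\<close>

lemma oper_trace_rho:
  assumes "\<And>f. f \<in> L2 a \<Longrightarrow> A f \<in> L2 a" "\<And>f. f \<in> L2 a \<Longrightarrow> B f \<in> L2 a"
    and adj: "\<And>u f. u \<in> L2 a \<Longrightarrow> f \<in> L2 a \<Longrightarrow> braket a u (A f) = braket a (B u) f"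
  shows "oper_trace a (rho a k s \<circ> A)
    = braket a (B (rwave (cos_wave a k s))) (rwave (cos_wave a k s))
    + braket a (B (rwave (sin_wave a k s))) (rwave (sin_wave a k s))" (is "_ = ?t")
proof (rule oper_trace_eq)
  let ?u = "\<lambda>j::nat. if j = 0 then rwave (cos_wave a k s) else rwave (sin_wave a k s)"
  have "oper_eq a (rho a k s \<circ> A) (\<lambda>f r. \<Sum>j<2. ketbra a (?u j) (B (?u j)) f r)"
    unfolding oper_eq_def
    by (auto simp: rho_rwave assms(1) adj ketbra_def numeral_2_eq_2 cos_wave_L2 sin_wave_L2)
  moreover have "?t = (\<Sum>j<2. braket a (B (?u j)) (?u j))" by (simp add: numeral_2_eq_2)
  moreover have "\<forall>j<2. ?u j \<in> L2 a \<and> B (?u j) \<in> L2 a"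
    by (auto simp: assms(2) cos_wave_L2 sin_wave_L2)
  ultimately show "has_oper_trace a (rho a k s \<circ> A) ?t"
    unfolding has_oper_trace_def
    by (intro exI[of _ 2] exI[of _ ?u] exI[of _ "\<lambda>j. B (?u j)"]) auto
qed

subsection \<open>Symmetric logarithmic derivatives\<close>

definition centered_phase :: "real \<Rightarrow> real \<Rightarrow> 3 \<Rightarrow> real \<times> real \<Rightarrow> real" where
  "centered_phase a k i r = phase k (axis i 1) r - (LINT r'|disk a. phase k (axis i 1) r') / (pi * a\<^sup>2)"

text \<open>The images of the two waves under the symmetric logarithmic derivative. They amount to
  $L_i \Phi_{\pm s} = \pm 2 \mathrm{i}\, (g_i - \overline{g_i})\, \Phi_{\pm s}$, where $g_i$ is the phase of
  the $i$-th unit vector and the mean $\overline{g_i}$ makes the prescription Hermitian on the span.\<close>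

definition sld_cos :: "real \<Rightarrow> real \<Rightarrow> 3 \<Rightarrow> real^3 \<Rightarrow> real \<times> real \<Rightarrow> real" where
  "sld_cos a k i s r = - 2 * centered_phase a k i r * sin_wave a k s r"

definition sld_sin :: "real \<Rightarrow> real \<Rightarrow> 3 \<Rightarrow> real^3 \<Rightarrow> real \<times> real \<Rightarrow> real" where
  "sld_sin a k i s r = 2 * centered_phase a k i r * cos_wave a k s r"

lemma continuous_centered_phase: "continuous_on UNIV (centered_phase a k i)"
  unfolding centered_phase_def[abs_def] by (intro continuous_intros continuous_phase)

lemma continuous_sld_cos: "continuous_on UNIV (sld_cos a k i s)"
  unfolding sld_cos_def[abs_def] by (intro continuous_intros continuous_sin_wave continuous_centered_phase)

lemma continuous_sld_sin: "continuous_on UNIV (sld_sin a k i s)"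
  unfolding sld_sin_def[abs_def] by (intro continuous_intros continuous_cos_wave continuous_centered_phase)

lemma sld_cos_L2: "rwave (sld_cos a k i s) \<in> L2 b" and sld_sin_L2: "rwave (sld_sin a k i s) \<in> L2 b"
  by (intro rwave_L2 continuous_sld_cos continuous_sld_sin)+

lemmas wave_L2 = cos_wave_L2 sin_wave_L2 sld_cos_L2 sld_sin_L2

lemma bounded_oper_comp:
  assumes A: "bounded_oper a A" and B: "bounded_oper a B"
  shows "bounded_oper a (\<lambda>f. A (B f))"
  unfolding bounded_oper_def
proof (intro conjI ballI allI)
  show "f \<in> L2 a \<Longrightarrow> A (B f) \<in> L2 a" for f by (intro bounded_operD(1)[OF A] bounded_operD(1)[OF B])
  show "AE r in disk a. A (B (\<lambda>x. c * f x + g x)) r = c * A (B f) r + A (B g) r"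
    if f: "f \<in> L2 a" and g: "g \<in> L2 a" for f g c
  proof -
    have "AE r in disk a. A (B (\<lambda>x. c * f x + g x)) r = A (\<lambda>x. c * B f x + B g x) r"
      by (intro bounded_oper_cong_AE[OF A] bounded_operD(1,2)[OF B] L2_intros f g)
    moreover have "AE r in disk a. A (\<lambda>x. c * B f x + B g x) r = c * A (B f) r + A (B g) r"
      by (intro bounded_operD(2)[OF A] bounded_operD(1)[OF B] f g)
    ultimately show ?thesis by eventually_elim simp
  qed
  obtain C D where C: "\<forall>f\<in>L2 a. l2norm a (A f) \<le> C * l2norm a f" and D: "\<forall>f\<in>L2 a. l2norm a (B f) \<le> D * l2norm a f"
    using bounded_operD(3)[OF A] bounded_operD(3)[OF B] by blast
  have "l2norm a (A (B f)) \<le> (\<bar>C\<bar> * D) * l2norm a f" if f: "f \<in> L2 a" for f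
  proof -
    have "l2norm a (A (B f)) \<le> C * l2norm a (B f)" using C bounded_operD(1)[OF B f] by blast
    also have "\<dots> \<le> \<bar>C\<bar> * l2norm a (B f)" by (intro mult_right_mono l2norm_nonneg) simp
    also have "\<dots> \<le> \<bar>C\<bar> * (D * l2norm a f)" using D f by (intro mult_left_mono) auto
    finally show ?thesis by simp
  qed
  then show "\<exists>C. \<forall>f\<in>L2 a. l2norm a (A (B f)) \<le> C * l2norm a f" by blast
qed

lemma l2norm_le_const:
  assumes "f \<in> L2 a" "AE r in disk a. cmod (f r) \<le> c" "c \<ge> 0"
  shows "l2norm a f \<le> c * l2norm a (\<lambda>r. 1)"
proof -
  have "(l2norm a f)\<^sup>2 \<le> (LINT r|disk a. c\<^sup>2)"
    unfolding l2norm_square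
  proof (rule integral_mono_AE)
    show "integrable (disk a) (\<lambda>r. (cmod (f r))\<^sup>2)" using assms(1) by (simp add: L2_def)
    show "AE r in disk a. (cmod (f r))\<^sup>2 \<le> c\<^sup>2" using assms(2) by eventually_elim (simp add: power_mono)
  qed (rule integrable_disk_continuous, intro continuous_intros)
  also have "\<dots> = (c * l2norm a (\<lambda>r. 1))\<^sup>2"
    by (simp add: power_mult_distrib l2norm_square)
  finally show ?thesis by (rule power2_le_imp_le) (simp add: assms(3) l2norm_nonneg)
qed

text \<open>The values on C and S determine both terms of the equation: L composed with the state
  directly, the state composed with L through self-adjointness. Half their sum has the kernel -N^2
  (g(r) - g(r')) sin(\<theta>(r) - \<theta>(r')), from which the mean of g has cancelled. This is
  the derivative of the cosine kernel of the state; convergence of the kernels uniformly on the disk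
  gives convergence in operator norm.\<close>

lemma is_sldI:
  assumes L: "bounded_oper a L" "selfadjoint_oper a L"
    and c: "AE r in disk a. L (rwave (cos_wave a k s)) r = rwave (sld_cos a k i s) r"
    and s: "AE r in disk a. L (rwave (sin_wave a k s)) r = rwave (sld_sin a k i s) r"
  shows "is_sld a k i s L"
proof -
  let ?c = "rwave (cos_wave a k s)" and ?s = "rwave (sin_wave a k s)"
  let ?yc = "rwave (sld_cos a k i s)" and ?ys = "rwave (sld_sin a k i s)"
  define N where "N = 1 / (sqrt pi * a)"
  define g where "g = phase k (axis i 1)"
  define \<theta> where "\<theta> = phase k s"
  define m where "m = (LINT r'|disk a. phase k (axis i 1) r') / (pi * a\<^sup>2)"
  have w: "cos_wave a k s x = N * cos (\<theta> x)" "sin_wave a k s x = N * sin (\<theta> x)"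
    "centered_phase a k i x = g x - m" for x
    by (simp_all add: cos_wave_def sin_wave_def N_def \<theta>_def centered_phase_def g_def m_def)
  define D where "D = (\<lambda>f r. (1/2) * (L (rho a k s f) r + rho a k s (L f) r))"
  have bD: "bounded_oper a D"
    unfolding D_def by (rule bounded_oper_scale[OF bounded_oper_add[OF
        bounded_oper_comp[OF L(1) bounded_oper_rho] bounded_oper_comp[OF bounded_oper_rho L(1)]]])
  have kernel: "AE r in disk a. D f r
      = braket a (rwave (\<lambda>r'. - (N\<^sup>2 * (g r - g r') * sin (\<theta> r - \<theta> r')))) f" if f: "f \<in> L2 a" for f
  proof -
    have "AE r in disk a. L (\<lambda>x. ?c x * braket a ?c f + ?s x * braket a ?s f) r
        = L ?c r * braket a ?c f + L ?s r * braket a ?s f"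
      by (intro bounded_oper_comb2 L wave_L2)
    then show ?thesis using c s
    proof eventually_elim
      case (elim r)
      have "braket a ?c (L f) = braket a ?yc f" "braket a ?s (L f) = braket a ?ys f"
        using selfadjoint_operD[OF L(2) cos_wave_L2 f] selfadjoint_operD[OF L(2) sin_wave_L2 f]
          braket_cong_left[OF c f bounded_operD(1)[OF L(1)]] braket_cong_left[OF s f bounded_operD(1)[OF L(1)]]
        by (metis wave_L2)+
      then have D: "D f r = (1/2) * (?yc r * braket a ?c f + ?ys r * braket a ?s f
          + ?c r * braket a ?yc f + ?s r * braket a ?ys f)"
        unfolding D_def rho_rwave[OF f] rho_rwave[OF bounded_operD(1)[OF L(1) f]] using elim
        by (simp add: rho_rwave[OF f, abs_def] add.assoc)
      have K: "rwave (\<lambda>r'. - (N\<^sup>2 * (g r - g r') * sin (\<theta> r - \<theta> r'))) = (\<lambda>r'. of_real (1/2) *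
          (of_real (sld_cos a k i s r) * ?c r' + of_real (sld_sin a k i s r) * ?s r'
          + of_real (cos_wave a k s r) * ?yc r' + of_real (sin_wave a k s r) * ?ys r'))"
        unfolding rwave_def of_real_mult[symmetric] of_real_add[symmetric] sld_cos_def sld_sin_def w
        by (rule ext, rule arg_cong[where f = of_real]) (simp add: sin_diff power2_eq_square field_simps)
      show ?case
        unfolding D K using f by (simp only: braket_linear L2_intros wave_L2) (simp add: rwave_def)
    qed
  qed
  have "bounded ((\<lambda>r. g r) ` cball 0 a)"
    unfolding g_def by (intro compact_imp_bounded compact_continuous_image
      continuous_on_subset[OF continuous_phase] subset_UNIV compact_cball)
  then obtain G where G: "\<forall>y\<in>g ` cball 0 a. norm y \<le> G" unfolding bounded_iff by blast
  \<comment> \<open>On the disk |g(r) - g(r')| is at most 2 G, and the second-order error is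
    quadratic in this difference.\<close>
  define B where "B = N\<^sup>2 * (2 * G)\<^sup>2"
  have B: "B \<ge> 0" by (simp add: B_def)
  \<comment> \<open>The norm of the constant function enters twice: when the kernel is bounded in
    the variable r' for Cauchy-Schwarz, and when the resulting pointwise bound in r is turned into a
    norm.\<close>
  define U where "U = l2norm a (\<lambda>r. 1)"
  have est: "l2norm a (\<lambda>r. (rho a k (s + t *\<^sub>R axis i 1) f r - rho a k s f r) / of_real t - D f r)
      \<le> (B * U\<^sup>2 * \<bar>t\<bar>) * l2norm a f" (is "l2norm a ?q \<le> _") if t: "t \<noteq> 0" and f: "f \<in> L2 a" for t f
  proof -
    \<comment> \<open>The kernel of the difference quotient minus \<open>D\<close>. The second-order
      bound for the cosine, with increment t (g(r) - g(r')), makes it of order |t| after the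
      division by t.\<close>
    define E where "E r r' = N\<^sup>2 * ((cos ((\<theta> r - \<theta> r') + t * (g r - g r')) - cos (\<theta> r - \<theta> r')) / t
        + (g r - g r') * sin (\<theta> r - \<theta> r'))" for r r'
    have cont: "continuous_on UNIV (E r)" for r
      unfolding E_def[abs_def] \<theta>_def g_def by (intro continuous_intros continuous_phase) (use t in simp)
    have E: "\<bar>E r r'\<bar> \<le> B * \<bar>t\<bar>" if r: "r \<in> cball 0 a" "r' \<in> cball 0 a" for r r'
    proof -
      let ?x = "\<theta> r - \<theta> r'" and ?d = "g r - g r'"
      have "\<bar>cos (?x + t * ?d) - cos ?x - (t * ?d) * (- sin ?x)\<bar> \<le> (t * ?d)\<^sup>2"
        by (rule second_order_bound[where f'' = "\<lambda>x. - cos x"]) (auto intro!: derivative_eq_intros)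
      moreover have "E r r' = N\<^sup>2 * ((cos (?x + t * ?d) - cos ?x - (t * ?d) * (- sin ?x)) / t)"
        using t by (simp add: E_def field_simps)
      ultimately have 1: "\<bar>E r r'\<bar> \<le> N\<^sup>2 * ((t * ?d)\<^sup>2 / \<bar>t\<bar>)"
        using t by (simp add: abs_mult divide_right_mono mult_left_mono)
      have 2: "(t * ?d)\<^sup>2 / \<bar>t\<bar> = ?d\<^sup>2 * \<bar>t\<bar>"
      proof -
        have "t\<^sup>2 / \<bar>t\<bar> = (\<bar>t\<bar> * \<bar>t\<bar>) / \<bar>t\<bar>" by (simp add: power2_eq_square)
        also have "\<dots> = \<bar>t\<bar>" using t by (intro nonzero_mult_div_cancel_right) simp
        finally have "?d\<^sup>2 * (t\<^sup>2 / \<bar>t\<bar>) = ?d\<^sup>2 * \<bar>t\<bar>" by (rule arg_cong)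
        then show ?thesis by (simp add: power_mult_distrib mult.commute)
      qed
      have "norm (g r) \<le> G" "norm (g r') \<le> G" using G r by blast+
      then have "\<bar>?d\<bar> \<le> \<bar>2 * G\<bar>" unfolding real_norm_def by linarith
      then have "?d\<^sup>2 \<le> (2 * G)\<^sup>2" by (rule abs_le_square_iff[THEN iffD1])
      then have "N\<^sup>2 * (?d\<^sup>2 * \<bar>t\<bar>) \<le> B * \<bar>t\<bar>"
        unfolding B_def mult.assoc by (intro mult_left_mono mult_right_mono) auto
      then show ?thesis using 1 unfolding 2 by linarith
    qed
    have bound: "cmod (braket a (rwave (E r)) f) \<le> (B * \<bar>t\<bar> * U) * l2norm a f" if r: "r \<in> cball 0 a" for r
    proof -
      have "cmod (braket a (rwave (E r)) f) \<le> l2norm a (rwave (E r)) * l2norm a f"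
        by (intro braket_Cauchy_Schwarz rwave_L2 cont f)
      also have "\<dots> \<le> (B * \<bar>t\<bar> * U) * l2norm a f"
        unfolding U_def
        by (intro mult_right_mono l2norm_nonneg l2norm_le_const rwave_L2 cont AE_I2)
           (use E r B in \<open>auto simp: space_disk rwave_def\<close>)
      finally show ?thesis .
    qed
    have q: "?q \<in> L2 a"
      using bounded_operD(1)[OF bounded_oper_rho f] bounded_operD(1)[OF bD f]
      unfolding divide_inverse by (intro L2_intros)
    have "AE r in disk a. r \<in> cball 0 a" using AE_space[of "disk a"] unfolding space_disk .
    then have "AE r in disk a. cmod (?q r) \<le> (B * \<bar>t\<bar> * U) * l2norm a f"
      using kernel[OF f]
    proof eventually_elim
      case (elim r)
      have shift: "phase k (s + t *\<^sub>R axis i 1) r - phase k (s + t *\<^sub>R axis i 1) r' = (\<theta> r - \<theta> r') + t * (g r - g r')" for r'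
        unfolding phase_add_scale \<theta>_def g_def by (simp add: algebra_simps)
      let ?A = "\<lambda>r'. N\<^sup>2 * cos ((\<theta> r - \<theta> r') + t * (g r - g r'))" and ?B = "\<lambda>r'. N\<^sup>2 * cos (\<theta> r - \<theta> r')"
        and ?D = "\<lambda>r'. - (N\<^sup>2 * (g r - g r') * sin (\<theta> r - \<theta> r'))"
      have cs: "continuous_on UNIV ?A" "continuous_on UNIV ?B" "continuous_on UNIV ?D"
        unfolding \<theta>_def g_def by (intro continuous_intros continuous_phase)+
      have K: "rwave (E r) = (\<lambda>r'. of_real (1 / t) * (rwave ?A r' - rwave ?B r') - rwave ?D r')"
        by (rule ext) (simp add: rwave_def E_def algebra_simps diff_divide_distrib)
      have "braket a (rwave (E r)) f = of_real (1 / t) * (braket a (rwave ?A) f - braket a (rwave ?B) f) - braket a (rwave ?D) f"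
        unfolding K using f cs
        by (simp only: braket_linear L2_intros rwave_L2 complex_cnj_complex_of_real)
      also have "\<dots> = ?q r"
        unfolding rho_kernel[OF f] shift elim(2) unfolding N_def \<theta>_def by simp
      finally show ?case using bound[OF elim(1)] by simp
    qed
    then have "l2norm a ?q \<le> ((B * \<bar>t\<bar> * U) * l2norm a f) * U"
      unfolding U_def by (intro l2norm_le_const q) (simp_all add: B l2norm_nonneg)
    then show ?thesis by (simp add: power2_eq_square mult_ac)
  qed
  have "\<forall>\<^sub>F t in at 0. \<forall>f\<in>L2 a.
      l2norm a (\<lambda>r. (rho a k (s + t *\<^sub>R axis i 1) f r - rho a k s f r) / of_real t - D f r) \<le> \<epsilon> * l2norm a f"
    if "\<epsilon> > 0" for \<epsilon>
  proof -
    have "((\<lambda>t. B * U\<^sup>2 * \<bar>t\<bar>) \<longlongrightarrow> 0) (at 0)" by (auto intro!: tendsto_eq_intros)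
    then have "\<forall>\<^sub>F t in at 0. B * U\<^sup>2 * \<bar>t\<bar> < \<epsilon>" using that by (rule order_tendstoD)
    moreover have "\<forall>\<^sub>F t :: real in at 0. t \<noteq> 0" by (simp add: eventually_at_filter)
    ultimately show ?thesis
    proof eventually_elim
      case (elim t)
      show ?case
      proof
        fix f assume f: "f \<in> L2 a"
        show "l2norm a (\<lambda>r. (rho a k (s + t *\<^sub>R axis i 1) f r - rho a k s f r) / of_real t - D f r) \<le> \<epsilon> * l2norm a f"
          using est[OF elim(2) f] mult_right_mono[OF less_imp_le[OF elim(1)] l2norm_nonneg[of a f]] by linarith
      qed
    qed
  qed
  then show ?thesis
    unfolding is_sld_def has_oper_partial_deriv_def using L bD unfolding D_def by blast
qed

lemma has_oper_partial_deriv_unique: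
  assumes R: "\<And>s f. f \<in> L2 a \<Longrightarrow> R s f \<in> L2 a"
    and D: "has_oper_partial_deriv a i R D s" "has_oper_partial_deriv a i R D' s"
    and f: "f \<in> L2 a"
  shows "AE r in disk a. D f r = D' f r"
proof -
  have b: "bounded_oper a D" "bounded_oper a D'" using D by (auto simp: has_oper_partial_deriv_def)
  define d where "d = (\<lambda>r. D f r - D' f r)"
  have d: "d \<in> L2 a" unfolding d_def by (intro L2_intros bounded_operD(1)[OF b(1)] bounded_operD(1)[OF b(2)] f)
  have "l2norm a d \<le> 0 + \<epsilon>" if e: "\<epsilon> > 0" for \<epsilon>
  proof -
    \<comment> \<open>Adding 1 keeps the denominator positive when f is a null function; the two
      quotients then contribute at most \<epsilon>/2 each.\<close>
    define \<delta> where "\<delta> = (\<epsilon> / 2) / (l2norm a f + 1)"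
    have \<delta>: "\<delta> > 0" using e l2norm_nonneg[of a f] by (simp add: \<delta>_def)
    define q where "q D t = (\<lambda>r. (R (s + t *\<^sub>R axis i 1) f r - R s f r) / of_real t - D f r)" for D t
    have "\<forall>\<^sub>F t in at 0. l2norm a (q D t) \<le> \<delta> * l2norm a f \<and> l2norm a (q D' t) \<le> \<delta> * l2norm a f"
    proof (rule eventually_conj)
      show "\<forall>\<^sub>F t in at 0. l2norm a (q D t) \<le> \<delta> * l2norm a f" "\<forall>\<^sub>F t in at 0. l2norm a (q D' t) \<le> \<delta> * l2norm a f"
        using D \<delta> f unfolding has_oper_partial_deriv_def q_def by (auto elim!: eventually_mono)
    qed
    then obtain t where t: "l2norm a (q D t) \<le> \<delta> * l2norm a f" "l2norm a (q D' t) \<le> \<delta> * l2norm a f"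
      using eventually_happens' trivial_limit_at by blast
    have qL: "q D t \<in> L2 a" "q D' t \<in> L2 a"
      unfolding q_def divide_inverse by (intro L2_intros R f bounded_operD(1)[OF b(1)] bounded_operD(1)[OF b(2)])+
    have "d = (\<lambda>r. q D' t r + (-1) * q D t r)" by (auto simp: d_def q_def)
    then have "l2norm a d \<le> l2norm a (q D' t) + l2norm a (\<lambda>r. (-1) * q D t r)"
      using l2norm_triangle[OF qL(2) L2_scale[OF qL(1), of "-1"]] by simp
    also have "\<dots> \<le> \<delta> * l2norm a f + \<delta> * l2norm a f" using t by (simp only: l2norm_scale) simp
    also have "\<dots> \<le> 2 * (\<delta> * (l2norm a f + 1))" using \<delta> by (simp add: algebra_simps)
    also have "\<dots> = \<epsilon>"
    proof -
      have "l2norm a f + 1 \<noteq> 0" using l2norm_nonneg[of a f] by linarith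
      then have "\<delta> * (l2norm a f + 1) = \<epsilon> / 2"
        unfolding \<delta>_def by (rule nonzero_eq_divide_eq[THEN iffD1]) (rule refl)
      then show ?thesis by simp
    qed
    finally show ?thesis by simp
  qed
  then have "l2norm a d \<le> 0" by (rule field_le_epsilon)
  then have "AE r in disk a. d r = 0" using l2norm_nonneg[of a d] by (intro AE_zero_if_l2norm_zero d) auto
  then show ?thesis by eventually_elim (simp add: d_def)
qed

text \<open>The difference $X$ of two solutions satisfies $X\rho + \rho X = 0$; multiplying by $X$ and
  taking the trace gives $2\,\mathrm{Tr}(X\rho X) = 0$.\<close>

lemma is_sld_unique:
  assumes sL: "is_sld a k i s L" and sL': "is_sld a k i s L'"
  shows "AE r in disk a. L (rwave (cos_wave a k s)) r = L' (rwave (cos_wave a k s)) r"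
    and "AE r in disk a. L (rwave (sin_wave a k s)) r = L' (rwave (sin_wave a k s)) r"
proof -
  let ?c = "rwave (cos_wave a k s)" and ?s = "rwave (sin_wave a k s)"
  have L: "bounded_oper a L" "selfadjoint_oper a L" and L': "bounded_oper a L'" "selfadjoint_oper a L'"
    using sL sL' by (auto simp: is_sld_def)
  define X where "X = (\<lambda>f r. L f r - L' f r)"
  have X: "bounded_oper a X" and sX: "selfadjoint_oper a X"
    unfolding X_def by (intro bounded_oper_diff selfadjoint_oper_diff L L')+
  note XL = bounded_operD(1)[OF X]
  have zero: "AE r in disk a. (X ?c r * braket a ?c f + X ?s r * braket a ?s f)
      + (?c r * braket a (X ?c) f + ?s r * braket a (X ?s) f) = 0" if f: "f \<in> L2 a" for f
  proof -
    have "AE r in disk a. (1/2) * (L (rho a k s f) r + rho a k s (L f) r)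
        = (1/2) * (L' (rho a k s f) r + rho a k s (L' f) r)"
      by (rule has_oper_partial_deriv_unique[where R = "rho a k" and i = i and s = s])
         (use sL sL' f bounded_operD(1)[OF bounded_oper_rho] in \<open>auto simp: is_sld_def\<close>)
    moreover have "AE r in disk a. X (\<lambda>x. ?c x * braket a ?c f + ?s x * braket a ?s f) r
        = X ?c r * braket a ?c f + X ?s r * braket a ?s f"
      by (intro bounded_oper_comb2 X wave_L2)
    ultimately show ?thesis
    proof eventually_elim
      case (elim r)
      have "rho a k s f = (\<lambda>x. ?c x * braket a ?c f + ?s x * braket a ?s f)"
        by (rule ext) (rule rho_rwave[OF f])
      then have 1: "X ?c r * braket a ?c f + X ?s r * braket a ?s f = L (rho a k s f) r - L' (rho a k s f) r"
        using elim(2) by (simp add: X_def)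
      have bX: "braket a (X ?c) f = braket a ?c (L f) - braket a ?c (L' f)"
        "braket a (X ?s) f = braket a ?s (L f) - braket a ?s (L' f)"
        using selfadjoint_operD[OF sX _ f] bounded_operD(1)[OF L(1) f] bounded_operD(1)[OF L'(1) f]
        by (simp_all add: wave_L2 braket_linear X_def)
      have 2: "?c r * braket a (X ?c) f + ?s r * braket a (X ?s) f = rho a k s (L f) r - rho a k s (L' f) r"
        unfolding bX rho_rwave[OF bounded_operD(1)[OF L(1) f]] rho_rwave[OF bounded_operD(1)[OF L'(1) f]]
        by (simp add: algebra_simps)
      have "L (rho a k s f) r + rho a k s (L f) r = L' (rho a k s f) r + rho a k s (L' f) r"
        using elim(1) by (rule mult_left_cancel[THEN iffD1, rotated]) simp
      then show ?case unfolding 1 2 by (simp add: algebra_simps)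
    qed
  qed
  have zero': "AE r in disk a. X (X ?c) r * braket a ?c f + X (X ?s) r * braket a ?s f
      + X ?c r * braket a (X ?c) f + X ?s r * braket a (X ?s) f = 0" if f: "f \<in> L2 a" for f
  proof -
    let ?T1 = "\<lambda>r. X ?c r * braket a ?c f + X ?s r * braket a ?s f"
    let ?T2 = "\<lambda>r. ?c r * braket a (X ?c) f + ?s r * braket a (X ?s) f"
    have T: "?T1 \<in> L2 a" "?T2 \<in> L2 a" by (intro L2_intros XL wave_L2)+
    \<comment> \<open>The zero function is written as 0 * 0 + 0 * 0 so that
      \<open>bounded_oper_comb2\<close> shows its image under X to vanish almost everywhere.\<close>
    have "AE r in disk a. X (\<lambda>r. ?T1 r * 1 + ?T2 r * 1) r = X (\<lambda>r. 0 * 0 + 0 * 0) r"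
      by (rule bounded_oper_cong_AE[OF X]) (intro L2_intros T, intro L2_intros, use zero[OF f] in simp)
    moreover have "AE r in disk a. X (\<lambda>r. 0 * 0 + 0 * 0) r = X (\<lambda>r. 0) r * 0 + X (\<lambda>r. 0) r * 0"
      by (rule bounded_oper_comb2[OF X L2_zero L2_zero])
    moreover have "AE r in disk a. X (\<lambda>r. ?T1 r * 1 + ?T2 r * 1) r = X ?T1 r * 1 + X ?T2 r * 1"
      by (rule bounded_oper_comb2[OF X T])
    moreover have "AE r in disk a. X ?T1 r = X (X ?c) r * braket a ?c f + X (X ?s) r * braket a ?s f"
      by (rule bounded_oper_comb2[OF X XL[OF wave_L2(1)] XL[OF wave_L2(2)]])
    moreover have "AE r in disk a. X ?T2 r = X ?c r * braket a (X ?c) f + X ?s r * braket a (X ?s) f"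
      by (rule bounded_oper_comb2[OF X wave_L2(1,2)])
    ultimately show ?thesis by eventually_elim (simp add: add.assoc)
  qed
  \<comment> \<open>These are the kets, and \<open>v\<close> the bras, of X X \<rho> + X \<rho> X.
    Moving one X across the inner product in the first two terms makes the formal trace twice the
    sum of the squared norms of X C and X S.\<close>
  define u where "u j = [X (X ?c), X (X ?s), X ?c, X ?s] ! j" for j
  define v where "v j = [?c, ?s, X ?c, X ?s] ! j" for j
  have sum4: "(\<Sum>j<4. F j) = F 0 + F 1 + F 2 + F 3" for F :: "nat \<Rightarrow> complex"
    by (simp add: eval_nat_numeral)
  have uv: "u 0 = X (X ?c)" "u 1 = X (X ?s)" "u 2 = X ?c" "u 3 = X ?s" "v 0 = ?c" "v 1 = ?s" "v 2 = X ?c" "v 3 = X ?s"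
    by (simp_all add: u_def v_def eval_nat_numeral)
  have "(\<Sum>j<4. braket a (v j) (u j)) = 0"
  proof (rule trace_of_zero_oper)
    fix j :: nat assume "j < 4"
    then have "j \<in> {0, 1, 2, 3}" by auto
    then show "u j \<in> L2 a" "v j \<in> L2 a" using uv XL wave_L2 by auto
  next
    fix f assume "f \<in> L2 a"
    then show "AE r in disk a. (\<Sum>j<4. u j r * braket a (v j) f) = 0"
      using zero' unfolding sum4 uv by simp
  qed
  moreover have sq: "braket a h h = complex_of_real ((l2norm a h)\<^sup>2)" for h
    unfolding l2norm_square by (rule braket_self)
  moreover have "braket a ?c (X (X ?c)) = complex_of_real ((l2norm a (X ?c))\<^sup>2)"
    "braket a ?s (X (X ?s)) = complex_of_real ((l2norm a (X ?s))\<^sup>2)"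
    unfolding sq[symmetric] by (rule selfadjoint_operD[OF sX _ XL, symmetric]; rule wave_L2)+
  ultimately have "complex_of_real (2 * ((l2norm a (X ?c))\<^sup>2 + (l2norm a (X ?s))\<^sup>2)) = 0"
    unfolding sum4 uv by (simp add: add.commute)
  then have "(l2norm a (X ?c))\<^sup>2 + (l2norm a (X ?s))\<^sup>2 = 0"
    unfolding of_real_eq_0_iff by (simp only: mult_eq_0_iff) simp
  then have "l2norm a (X ?c) = 0" "l2norm a (X ?s) = 0"
    unfolding sum_power2_eq_zero_iff by blast+
  then have "AE r in disk a. X ?c r = 0" "AE r in disk a. X ?s r = 0"
    by (auto intro!: AE_zero_if_l2norm_zero XL wave_L2)
  then show "AE r in disk a. L ?c r = L' ?c r" "AE r in disk a. L ?s r = L' ?s r"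
    by (auto elim!: eventually_mono simp: X_def)
qed

text \<open>With the dual basis $\tilde c, \tilde s$ and $p_\beta = y_\beta - \frac12 \sum_\alpha
  \langle\alpha|y_\beta\rangle\,\tilde\alpha$, the operator $\sum_\beta |p_\beta\rangle\langle\tilde\beta|
  + |\tilde\beta\rangle\langle p_\beta|$ is self-adjoint by construction and maps $\beta$ to $y_\beta$;
  the factor $\frac12$ compensates for the part of $y_\beta$ in the span, which occurs in both terms.\<close>

lemma ex_selfadjoint_oper:
  assumes L2: "c \<in> L2 a" "s \<in> L2 a" "yc \<in> L2 a" "ys \<in> L2 a" "ct \<in> L2 a" "st \<in> L2 a"
    and dual: "braket a ct c = 1" "braket a ct s = 0" "braket a st c = 0" "braket a st s = 1"
    and herm: "braket a c yc = braket a yc c" "braket a s ys = braket a ys s" "braket a c ys = braket a yc s"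
  shows "\<exists>L. bounded_oper a L \<and> selfadjoint_oper a L \<and> L c = yc \<and> L s = ys"
proof -
  define pc where "pc = (\<lambda>r. yc r - ((braket a c yc / 2) * ct r + (braket a s yc / 2) * st r))"
  define ps where "ps = (\<lambda>r. ys r - ((braket a c ys / 2) * ct r + (braket a s ys / 2) * st r))"
  have p: "pc \<in> L2 a" "ps \<in> L2 a" unfolding pc_def ps_def by (intro L2_intros L2)+
  define L where "L = (\<lambda>f r. (ketbra a pc ct f r + ketbra a ct pc f r) + (ketbra a ps st f r + ketbra a st ps f r))"
  have herm': "braket a s yc = braket a ys c"
    using arg_cong[OF herm(3), of cnj] by (simp add: braket_cnj)
  have b: "braket a pc c = braket a c yc / 2" "braket a pc s = braket a c ys / 2"
    "braket a ps c = braket a s yc / 2" "braket a ps s = braket a s ys / 2"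
    unfolding pc_def ps_def using L2
    by (simp_all only: braket_linear L2_intros dual) (simp_all add: braket_cnj herm herm')
  have "bounded_oper a L" "selfadjoint_oper a L"
    unfolding L_def
    by (intro bounded_oper_add bounded_oper_ketbra selfadjoint_oper_add selfadjoint_oper_ketbra_sym p L2)+
  moreover have "L c = yc" "L s = ys"
    unfolding L_def ketbra_def b dual by (auto simp: pc_def ps_def algebra_simps)
  ultimately show ?thesis by blast
qed

text \<open>The squared norm of ss C - cs S is ss times the determinant, so a zero determinant makes
  this function vanish inside the disk. At the centre the phase is 0, hence C \<noteq> 0 and S = 0,
  which forces ss = 0. Then the sine of the phase vanishes throughout the open disk; near the centre
  the phase is too small to be a nonzero multiple of pi, so it is itself zero there, and its values
  at three points already give s = 0.\<close>

lemma gram_det_nonzero: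
  assumes a: "a > 0" and k: "k > 0" and s: "s \<noteq> 0"
  defines "cc \<equiv> LINT r|disk a. cos_wave a k s r * cos_wave a k s r"
    and "ss \<equiv> LINT r|disk a. sin_wave a k s r * sin_wave a k s r"
    and "cs \<equiv> LINT r|disk a. cos_wave a k s r * sin_wave a k s r"
  shows "cc * ss - cs * cs \<noteq> 0"
proof
  assume 0: "cc * ss - cs * cs = 0"
  let ?c = "cos_wave a k s" and ?s = "sin_wave a k s"
  have i: "integrable (disk a) (\<lambda>r. ?c r * ?c r)" "integrable (disk a) (\<lambda>r. ?s r * ?s r)"
    "integrable (disk a) (\<lambda>r. ?c r * ?s r)"
    by (intro integrable_disk_continuous continuous_intros continuous_cos_wave continuous_sin_wave)+
  have "(LINT r|disk a. (ss * ?c r - cs * ?s r)\<^sup>2)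
      = (LINT r|disk a. ss\<^sup>2 * (?c r * ?c r) - 2 * ss * cs * (?c r * ?s r) + cs\<^sup>2 * (?s r * ?s r))"
    by (intro Bochner_Integration.integral_cong) (auto simp: power2_eq_square algebra_simps)
  also have "\<dots> = ss\<^sup>2 * cc - 2 * ss * cs * cs + cs\<^sup>2 * ss"
    unfolding cc_def cs_def ss_def using i by simp
  also have "\<dots> = ss * (cc * ss - cs * cs)" by (simp add: power2_eq_square algebra_simps)
  finally have "(LINT r|disk a. (ss * ?c r - cs * ?s r)\<^sup>2) = 0" using 0 by simp
  then have "ss * ?c 0 - cs * ?s 0 = 0"
    by (rule zero_if_integral_disk_square_zero[rotated])
       (use a in \<open>auto intro!: continuous_intros continuous_cos_wave continuous_sin_wave\<close>)
  moreover have "?c 0 \<noteq> 0" "?s 0 = 0" using a by (simp_all add: cos_wave_def sin_wave_def phase_def)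
  ultimately have "ss = 0" by simp
  then have "(LINT r|disk a. (?s r)\<^sup>2) = 0" by (simp add: ss_def power2_eq_square)
  then have "?s r = 0" if "r \<in> ball 0 a" for r
    using zero_if_integral_disk_square_zero[OF continuous_sin_wave _ that] by blast
  then have sin0: "sin (phase k s r) = 0" if "r \<in> ball 0 a" for r
    using that a by (simp add: sin_wave_def)
  define S where "S = k * (\<bar>s$1\<bar> + \<bar>s$2\<bar> + \<bar>s$3\<bar>)"
  have S: "S \<ge> 0" using k by (simp add: S_def)
  \<comment> \<open>A radius with three properties: e < a stays inside the disk, e \<le> 1 gives
    e^2/2 \<le> e for the quadratic term, and e S \<le> 1 keeps the phase strictly between -pi and
    pi.\<close>
  define e where "e = min (a / 2) (min 1 (1 / (S + 1)))"
  have e: "e > 0" "e < a" using a S by (auto simp: e_def)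
  have e1: "e \<le> 1" unfolding e_def by (rule min.coboundedI2[OF min.cobounded1])
  have "e \<le> 1 / (S + 1)" unfolding e_def by (rule min.coboundedI2[OF min.cobounded2])
  then have "e * S \<le> 1 / (S + 1) * S" using S by (rule mult_right_mono)
  also have "\<dots> \<le> 1" using S by simp
  finally have eS: "e * S \<le> 1" .
  have zero: "phase k s r = 0" if r: "norm r = e" "\<bar>fst r\<bar> \<le> e" "\<bar>snd r\<bar> \<le> e" for r
  proof (rule sin_eq_0_pi)
    have "\<bar>s$1 * fst r + s$2 * snd r - s$3 * e\<^sup>2 / 2\<bar> \<le> \<bar>s$1 * fst r\<bar> + \<bar>s$2 * snd r\<bar> + \<bar>s$3 * e\<^sup>2 / 2\<bar>" by linarith
    also have "\<dots> \<le> \<bar>s$1\<bar> * e + \<bar>s$2\<bar> * e + \<bar>s$3\<bar> * e"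
    proof (intro add_mono)
      have "e\<^sup>2 / 2 \<le> e" using e e1 mult_left_mono[of e 1 e] by (simp add: power2_eq_square)
      then show "\<bar>s$3 * e\<^sup>2 / 2\<bar> \<le> \<bar>s$3\<bar> * e"
        using mult_left_mono[of "e\<^sup>2 / 2" e "\<bar>s$3\<bar>"] by (simp add: abs_mult)
    qed (use r in \<open>auto simp: abs_mult intro!: mult_left_mono\<close>)
    finally have "k * \<bar>s$1 * fst r + s$2 * snd r - s$3 * e\<^sup>2 / 2\<bar> \<le> k * (\<bar>s$1\<bar> * e + \<bar>s$2\<bar> * e + \<bar>s$3\<bar> * e)"
      using k by (intro mult_left_mono) auto
    also have "\<dots> = e * S" by (simp add: S_def algebra_simps)
    finally have "\<bar>phase k s r\<bar> \<le> 1"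
      using eS k r(1) by (simp add: phase_def abs_mult)
    then show "- pi < phase k s r" "phase k s r < pi" using pi_gt3 by auto
    show "sin (phase k s r) = 0" using sin0[of r] r e by simp
  qed
  \<comment> \<open>The two opposite points on the first axis separate s_1 from s_3; the third point
    then yields s_2.\<close>
  have "phase k s (e, 0) = 0" "phase k s (- e, 0) = 0" "phase k s (0, e) = 0"
    by (intro zero; use e in \<open>simp add: norm_Pair\<close>)+
  then have "s$1 * e - s$3 * e\<^sup>2 / 2 = 0" "- (s$1 * e) - s$3 * e\<^sup>2 / 2 = 0" "s$2 * e - s$3 * e\<^sup>2 / 2 = 0"
    using k e by (auto simp: phase_def norm_Pair)
  then have "s$1 * e = 0" "s$2 * e = 0" "s$3 * e\<^sup>2 = 0" by linarith+
  then have "s = 0" using e by (simp add: vec_eq_iff forall_3)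
  then show False using \<open>s \<noteq> 0\<close> by simp
qed

lemma cos_wave_sin_wave_square:
  "a > 0 \<Longrightarrow> cos_wave a k s r * cos_wave a k s r + sin_wave a k s r * sin_wave a k s r = 1 / (pi * a\<^sup>2)"
  using sin_cos_squared_add2[of "phase k s r"]
  by (simp add: cos_wave_def sin_wave_def field_simps power2_eq_square)

lemma integral_centered_phase:
  assumes "a > 0"
  shows "(LINT r|disk a. centered_phase a k i r) = 0"
proof -
  have "(LINT r|disk a. centered_phase a k i r) = (LINT r|disk a. phase k (axis i 1) r)
      - (LINT r|disk a. (LINT r'|disk a. phase k (axis i 1) r') / (pi * a\<^sup>2))"
    unfolding centered_phase_def
    by (intro Bochner_Integration.integral_diff integrable_disk_continuous continuous_phase continuous_intros)
  then show ?thesis unfolding integral_disk_const[OF assms] using assms by simp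
qed

lemma ex_sld:
  assumes a: "a > 0" and k: "k > 0" and s: "s \<noteq> 0"
  shows "\<exists>L. is_sld a k i s L \<and> L (rwave (cos_wave a k s)) = rwave (sld_cos a k i s)
     \<and> L (rwave (sin_wave a k s)) = rwave (sld_sin a k i s)"
proof -
  let ?c = "rwave (cos_wave a k s)" and ?s = "rwave (sin_wave a k s)"
  let ?yc = "rwave (sld_cos a k i s)" and ?ys = "rwave (sld_sin a k i s)"
  define cc ss cs where "cc = (LINT r|disk a. cos_wave a k s r * cos_wave a k s r)"
    and "ss = (LINT r|disk a. sin_wave a k s r * sin_wave a k s r)"
    and "cs = (LINT r|disk a. cos_wave a k s r * sin_wave a k s r)"
  define \<Delta> where "\<Delta> = cc * ss - cs * cs"
  have \<Delta>: "\<Delta> \<noteq> 0" unfolding \<Delta>_def cc_def ss_def cs_def by (rule gram_det_nonzero[OF a k s])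
  have gram: "braket a ?c ?c = of_real cc" "braket a ?s ?s = of_real ss"
    "braket a ?c ?s = of_real cs" "braket a ?s ?c = of_real cs"
    unfolding braket_rwave cc_def ss_def cs_def by (simp_all add: mult.commute)
  \<comment> \<open>The dual basis of C and S, obtained by applying the inverse of their 2 by 2 Gram
    matrix.\<close>
  define ct where "ct = (\<lambda>r. of_real (ss / \<Delta>) * ?c r - of_real (cs / \<Delta>) * ?s r)"
  define st where "st = (\<lambda>r. of_real (cc / \<Delta>) * ?s r - of_real (cs / \<Delta>) * ?c r)"
  have dual: "braket a ct ?c = of_real (ss / \<Delta> * cc - cs / \<Delta> * cs)"
    "braket a ct ?s = of_real (ss / \<Delta> * cs - cs / \<Delta> * ss)"
    "braket a st ?c = of_real (cc / \<Delta> * cs - cs / \<Delta> * cc)"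
    "braket a st ?s = of_real (cc / \<Delta> * ss - cs / \<Delta> * cs)"
    unfolding ct_def st_def
    by (simp_all only: braket_linear L2_intros wave_L2 gram complex_cnj_complex_of_real of_real_mult of_real_diff)
  have d: "ss / \<Delta> * cc - cs / \<Delta> * cs = (cc * ss - cs * cs) / \<Delta>" "ss / \<Delta> * cs - cs / \<Delta> * ss = 0"
    "cc / \<Delta> * cs - cs / \<Delta> * cc = 0" "cc / \<Delta> * ss - cs / \<Delta> * cs = (cc * ss - cs * cs) / \<Delta>"
    by (simp_all add: diff_divide_distrib mult.commute)
  note d = d[folded \<Delta>_def]
  \<comment> \<open>The off-diagonal Hermitian condition: the difference of its two sides is twice
    the integral of the centred phase against the constant C^2 + S^2. The diagonal conditions are
    immediate because all functions are real.\<close>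
  have "(LINT r|disk a. cos_wave a k s r * sld_sin a k i s r) - (LINT r|disk a. sld_cos a k i s r * sin_wave a k s r)
      = (LINT r|disk a. cos_wave a k s r * sld_sin a k i s r - sld_cos a k i s r * sin_wave a k s r)"
    by (intro Bochner_Integration.integral_diff[symmetric] integrable_disk_continuous continuous_intros
      continuous_cos_wave continuous_sin_wave continuous_sld_cos continuous_sld_sin)
  also have "\<dots> = (LINT r|disk a. 2 * (1 / (pi * a\<^sup>2)) * centered_phase a k i r)"
  proof (intro Bochner_Integration.integral_cong refl)
    fix r
    show "cos_wave a k s r * sld_sin a k i s r - sld_cos a k i s r * sin_wave a k s r
        = 2 * (1 / (pi * a\<^sup>2)) * centered_phase a k i r"
      unfolding cos_wave_sin_wave_square[OF a, symmetric, of k s r] sld_cos_def sld_sin_def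
      by (simp add: algebra_simps)
  qed
  also have "\<dots> = 0" using integral_centered_phase[OF a, of k i] by simp
  finally have herm: "braket a ?c ?ys = braket a ?yc ?s" unfolding braket_rwave by simp
  have "\<exists>L. bounded_oper a L \<and> selfadjoint_oper a L \<and> L ?c = ?yc \<and> L ?s = ?ys"
  proof (rule ex_selfadjoint_oper[where ct = ct and st = st])
    show "ct \<in> L2 a" "st \<in> L2 a" unfolding ct_def st_def by (intro L2_intros wave_L2)+
    show "braket a ct ?c = 1" "braket a ct ?s = 0" "braket a st ?c = 0" "braket a st ?s = 1"
      unfolding dual d using \<Delta> by simp_all
    show "braket a ?c ?yc = braket a ?yc ?c" "braket a ?s ?ys = braket a ?ys ?s"
      unfolding braket_rwave by (simp_all add: mult.commute)
  qed (rule herm wave_L2)+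
  then obtain L where L: "bounded_oper a L" "selfadjoint_oper a L" "L ?c = ?yc" "L ?s = ?ys" by blast
  have "is_sld a k i s L" by (rule is_sldI[OF L(1,2)]) (simp_all add: L(3,4))
  with L show ?thesis by blast
qed

subsection \<open>Formulas for the Fisher information\<close>

lemma outcome_prob_eq:
  assumes "bounded_oper a P" "selfadjoint_oper a P"
  shows "outcome_prob a k P s = Re (braket a (P (rwave (cos_wave a k s))) (rwave (cos_wave a k s))
    + braket a (P (rwave (sin_wave a k s))) (rwave (sin_wave a k s)))"
  unfolding outcome_prob_def
  by (subst oper_trace_rho[where B = P])
     (auto simp: bounded_operD(1)[OF assms(1)] selfadjoint_operD[OF assms(2)])

text \<open>Self-adjointness turns the trace into inner products of L_i C with P L_j C and of L_i S
  with P L_j S. By uniqueness these vectors do not depend on the chosen family up to null sets, and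
  \<open>L0\<close> shows that a family exists; so the definite description denotes this
  value.\<close>

lemma quantum_fisher_eq:
  assumes a: "a > 0" and k: "k > 0" and s: "s \<noteq> 0" and P: "bounded_oper a P" "selfadjoint_oper a P"
  shows "quantum_fisher a k P s $ i $ j
    = Re (braket a (rwave (sld_cos a k i s)) (P (rwave (sld_cos a k j s)))
        + braket a (rwave (sld_sin a k i s)) (P (rwave (sld_sin a k j s))))"
proof -
  let ?c = "rwave (cos_wave a k s)" and ?s = "rwave (sin_wave a k s)"
  define yc ys where "yc i = rwave (sld_cos a k i s)" and "ys i = rwave (sld_sin a k i s)" for i
  have y: "yc i \<in> L2 a" "ys i \<in> L2 a" for i by (simp_all add: yc_def ys_def wave_L2)
  obtain L0 where L0: "\<And>i. is_sld a k i s (L0 i)" "\<And>i. L0 i ?c = yc i" "\<And>i. L0 i ?s = ys i"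
    using ex_sld[OF a k s] unfolding yc_def ys_def by metis
  have val: "oper_trace a (rho a k s \<circ> L i \<circ> P \<circ> L j) = braket a (yc i) (P (yc j)) + braket a (ys i) (P (ys j))"
    if sld: "\<forall>p. is_sld a k p s (L p)" for L
  proof -
    have b: "bounded_oper a (L p)" "selfadjoint_oper a (L p)" for p using sld by (auto simp: is_sld_def)
    note bL = bounded_operD(1)[OF b(1)] and bP = bounded_operD(1)[OF P(1)]
    note sL = selfadjoint_operD[OF b(2)] and sP = selfadjoint_operD[OF P(2)]
    have "oper_trace a (rho a k s \<circ> L i \<circ> P \<circ> L j) = oper_trace a (rho a k s \<circ> (L i \<circ> P \<circ> L j))"
      by (simp add: comp_assoc)
    also have "\<dots> = braket a (L j (P (L i ?c))) ?c + braket a (L j (P (L i ?s))) ?s"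
      by (subst oper_trace_rho[where B = "\<lambda>f. L j (P (L i f))"]) (simp_all add: bL bP sL sP)
    also have "\<dots> = braket a (L i ?c) (P (L j ?c)) + braket a (L i ?s) (P (L j ?s))"
      by (simp add: sL sP bL bP wave_L2)
    also have "braket a (L i ?c) (P (L j ?c)) = braket a (yc i) (P (yc j))"
    proof -
      have c: "AE r in disk a. L p ?c r = yc p r" for p
        using is_sld_unique(1)[OF sld[rule_format] L0(1)] by (simp add: L0)
      have "braket a (L i ?c) (P (L j ?c)) = braket a (yc i) (P (L j ?c))"
        by (rule braket_cong_left[OF c]) (simp_all add: bL bP y wave_L2)
      also have "\<dots> = braket a (yc i) (P (yc j))"
        by (rule braket_cong_right[OF bounded_oper_cong_AE[OF P(1) _ _ c]]) (simp_all add: bL bP y wave_L2)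
      finally show ?thesis .
    qed
    also have "braket a (L i ?s) (P (L j ?s)) = braket a (ys i) (P (ys j))"
    proof -
      have c: "AE r in disk a. L p ?s r = ys p r" for p
        using is_sld_unique(2)[OF sld[rule_format] L0(1)] by (simp add: L0)
      have "braket a (L i ?s) (P (L j ?s)) = braket a (ys i) (P (L j ?s))"
        by (rule braket_cong_left[OF c]) (simp_all add: bL bP y wave_L2)
      also have "\<dots> = braket a (ys i) (P (ys j))"
        by (rule braket_cong_right[OF bounded_oper_cong_AE[OF P(1) _ _ c]]) (simp_all add: bL bP y wave_L2)
      finally show ?thesis .
    qed
    finally show ?thesis .
  qed
  have "(THE x. \<exists>L :: 3 \<Rightarrow> oper. (\<forall>p. is_sld a k p s (L p)) \<and>
     x = Re (oper_trace a (rho a k s \<circ> L i \<circ> P \<circ> L j))) = Re (braket a (yc i) (P (yc j)) + braket a (ys i) (P (ys j)))"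
  proof (rule the_equality)
    show "\<exists>L. (\<forall>p. is_sld a k p s (L p)) \<and>
      Re (braket a (yc i) (P (yc j)) + braket a (ys i) (P (ys j))) = Re (oper_trace a (rho a k s \<circ> L i \<circ> P \<circ> L j))"
      using L0(1) val[of L0] by (intro exI[of _ L0]) simp
  qed (use val in auto)
  then show ?thesis unfolding quantum_fisher_def yc_def ys_def by simp
qed

subsection \<open>Cosine and sine transforms\<close>

text \<open>For real w, \<open>cos_tf\<close> and \<open>sin_tf\<close> are the real and imaginary
  parts of the overlap of w with the wave \<open>Phi a k s\<close>.\<close>

definition cos_tf :: "real \<Rightarrow> real \<Rightarrow> (real \<times> real \<Rightarrow> real) \<Rightarrow> real^3 \<Rightarrow> real" where
  "cos_tf a k w s = (LINT r|disk a. w r * cos_wave a k s r)"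

definition sin_tf :: "real \<Rightarrow> real \<Rightarrow> (real \<times> real \<Rightarrow> real) \<Rightarrow> real^3 \<Rightarrow> real" where
  "sin_tf a k w s = (LINT r|disk a. w r * sin_wave a k s r)"

lemma cos_tf_scale: "cos_tf a k (\<lambda>r. c * w r) s = c * cos_tf a k w s"
  unfolding cos_tf_def by (simp add: mult.assoc)

lemma cos_tf_add: "continuous_on UNIV u \<Longrightarrow> continuous_on UNIV w \<Longrightarrow>
    cos_tf a k (\<lambda>r. u r + w r) s = cos_tf a k u s + cos_tf a k w s"
  unfolding cos_tf_def distrib_right
  by (intro Bochner_Integration.integral_add integrable_disk_continuous continuous_intros continuous_cos_wave)

lemma cos_tf_0: "cos_tf a k w 0 = (1 / (sqrt pi * a)) * (LINT r|disk a. w r)"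
  by (simp add: cos_tf_def cos_wave_def phase_def)

lemma sin_tf_0: "sin_tf a k w 0 = 0"
  by (simp add: sin_tf_def sin_wave_def phase_def)

lemma cos_tf_alt: "cos_tf a k w s = (1 / (sqrt pi * a)) * (LINT r|disk a. w r * cos (phase k s r))"
  and sin_tf_alt: "sin_tf a k w s = (1 / (sqrt pi * a)) * (LINT r|disk a. w r * sin (phase k s r))"
  unfolding cos_tf_def sin_tf_def cos_wave_def sin_wave_def
  by (simp_all only: mult.left_commute[of "w _"] integral_mult_right_zero)

text \<open>Differentiating along v only multiplies the weight by the phase of v and exchanges
  cosine and sine. The two transforms are thus closed under differentiation, so the Hessian can be
  computed by the same rules.\<close>

lemma DERIV_cos_tf:
  assumes "continuous_on UNIV w"
  shows "((\<lambda>t. cos_tf a k w (s + t *\<^sub>R v)) has_real_derivative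
     - sin_tf a k (\<lambda>r. w r * phase k v r) (s + t *\<^sub>R v)) (at t)"
proof -
  have "((\<lambda>t. LINT r|disk a. w r * cos (phase k s r + t * phase k v r)) has_real_derivative
      (LINT r|disk a. (w r * phase k v r) * - sin (phase k s r + t * phase k v r))) (at t)"
    by (rule has_real_derivative_integral_disk[where f'' = "\<lambda>x. - cos x"])
       (auto intro!: derivative_eq_intros assms continuous_phase)
  from DERIV_cmult[OF this, of "1 / (sqrt pi * a)"] show ?thesis
    unfolding cos_tf_alt sin_tf_alt phase_add_scale by simp
qed

lemma DERIV_sin_tf:
  assumes "continuous_on UNIV w"
  shows "((\<lambda>t. sin_tf a k w (s + t *\<^sub>R v)) has_real_derivative
     cos_tf a k (\<lambda>r. w r * phase k v r) (s + t *\<^sub>R v)) (at t)"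
proof -
  have "((\<lambda>t. LINT r|disk a. w r * sin (phase k s r + t * phase k v r)) has_real_derivative
      (LINT r|disk a. (w r * phase k v r) * cos (phase k s r + t * phase k v r))) (at t)"
    by (rule has_real_derivative_integral_disk[where f'' = "\<lambda>x. - sin x"])
       (auto intro!: derivative_eq_intros assms continuous_phase)
  from DERIV_cmult[OF this, of "1 / (sqrt pi * a)"] show ?thesis
    unfolding cos_tf_alt sin_tf_alt phase_add_scale by simp
qed

lemma tendsto_tf:
  assumes "continuous_on UNIV w"
  shows "((\<lambda>t. cos_tf a k w (t *\<^sub>R v)) \<longlongrightarrow> cos_tf a k w 0) (at 0)"
    and "((\<lambda>t. sin_tf a k w (t *\<^sub>R v)) \<longlongrightarrow> 0) (at 0)"
  using DERIV_isCont[OF DERIV_cos_tf[OF assms, of a k 0 v 0]]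
    DERIV_isCont[OF DERIV_sin_tf[OF assms, of a k 0 v 0]]
  by (simp_all add: isCont_def sin_tf_0)

subsection \<open>Limits of the Fisher information\<close>

lemma tendsto_matrix:
  fixes f :: "'b \<Rightarrow> real^3^3"
  assumes "\<And>i j. ((\<lambda>t. f t $ i $ j) \<longlongrightarrow> M i j) F"
  shows "(f \<longlongrightarrow> (\<chi> i j. M i j)) F"
  by (intro vec_tendstoI) (simp add: assms)

lemma eventually_scale_nonzero: "v \<noteq> 0 \<Longrightarrow> \<forall>\<^sub>F t in at (0 :: real). t *\<^sub>R v \<noteq> (0 :: real^3)"
  by (simp add: eventually_at_filter)

lemma tendsto_quantum_fisher:
  assumes "v \<noteq> 0" "\<And>s. s \<noteq> 0 \<Longrightarrow> quantum_fisher a k P s $ i $ j = G s"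
    and "((\<lambda>t. G (t *\<^sub>R v)) \<longlongrightarrow> L) (at 0)"
  shows "((\<lambda>t. quantum_fisher a k P (t *\<^sub>R v) $ i $ j) \<longlongrightarrow> L) (at 0)"
  using assms(3)
  by (rule Lim_transform_eventually)
     (use eventually_scale_nonzero[OF assms(1)] assms(2) in \<open>auto elim: eventually_mono\<close>)

section \<open>Projectors onto a single real wave\<close>

abbreviation proj :: "real \<Rightarrow> (real \<times> real \<Rightarrow> real) \<Rightarrow> oper" where
  "proj a w \<equiv> ketbra a (rwave w) (rwave w)"

lemma bounded_oper_proj: "continuous_on UNIV w \<Longrightarrow> bounded_oper a (proj a w)"
  by (intro bounded_oper_ketbra rwave_L2)

lemma selfadjoint_oper_proj: "continuous_on UNIV w \<Longrightarrow> selfadjoint_oper a (proj a w)"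
  by (intro selfadjoint_oper_ketbra rwave_L2)

lemma braket_proj: "braket a u (proj a w v) = braket a u (rwave w) * braket a (rwave w) v"
  unfolding ketbra_def by (rule braket_scale_right')

lemma outcome_prob_proj:
  assumes "continuous_on UNIV w"
  shows "outcome_prob a k (proj a w) s = (cos_tf a k w s)\<^sup>2 + (sin_tf a k w s)\<^sup>2"
proof -
  have "braket a (proj a w (rwave u)) (rwave u) = of_real ((LINT r|disk a. w r * u r)\<^sup>2)" for u
    unfolding braket_cnj[of a "rwave u", symmetric] braket_proj
    by (simp add: braket_rwave mult.commute[of "u _"] power2_eq_square)
  then show ?thesis
    unfolding outcome_prob_eq[OF bounded_oper_proj[OF assms] selfadjoint_oper_proj[OF assms]]
    by (simp add: cos_tf_def sin_tf_def)
qed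

lemma quantum_fisher_proj:
  assumes "a > 0" "k > 0" "continuous_on UNIV w" "s \<noteq> 0"
  shows "quantum_fisher a k (proj a w) s $ i $ j =
    4 * (sin_tf a k (\<lambda>r. w r * centered_phase a k i r) s * sin_tf a k (\<lambda>r. w r * centered_phase a k j r) s
       + cos_tf a k (\<lambda>r. w r * centered_phase a k i r) s * cos_tf a k (\<lambda>r. w r * centered_phase a k j r) s)"
proof -
  have "(\<lambda>r. sld_cos a k i s r * w r) = (\<lambda>r. (-2) * (w r * centered_phase a k i r * sin_wave a k s r))"
    "(\<lambda>r. sld_sin a k i s r * w r) = (\<lambda>r. 2 * (w r * centered_phase a k i r * cos_wave a k s r))" for i
    by (auto simp: sld_cos_def sld_sin_def)
  then have y: "(LINT r|disk a. sld_cos a k i s r * w r) = -2 * sin_tf a k (\<lambda>r. w r * centered_phase a k i r) s"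
    "(LINT r|disk a. sld_sin a k i s r * w r) = 2 * cos_tf a k (\<lambda>r. w r * centered_phase a k i r) s" for i
    unfolding sin_tf_def cos_tf_def by (simp_all only: integral_mult_right_zero)
  show ?thesis
    unfolding quantum_fisher_eq[OF assms(1,2,4) bounded_oper_proj[OF assms(3)] selfadjoint_oper_proj[OF assms(3)]]
      braket_proj braket_rwave mult.commute[of "w _"] y
    by simp
qed

text \<open>The closed form of the derivative of the outcome probability of \<open>proj a w\<close>
  at s along v, expressed by transforms so that it can be differentiated again.\<close>

definition prob_deriv :: "real \<Rightarrow> real \<Rightarrow> (real \<times> real \<Rightarrow> real) \<Rightarrow> real^3 \<Rightarrow> real^3 \<Rightarrow> real" where
  "prob_deriv a k w v s = 2 * (sin_tf a k w s * cos_tf a k (\<lambda>r. w r * phase k v r) s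
     - cos_tf a k w s * sin_tf a k (\<lambda>r. w r * phase k v r) s)"

lemma DERIV_outcome_prob_proj:
  assumes w: "continuous_on UNIV w"
  shows "((\<lambda>t. outcome_prob a k (proj a w) (s + t *\<^sub>R v)) has_real_derivative prob_deriv a k w v s) (at 0)"
  unfolding outcome_prob_proj[OF w] prob_deriv_def
  by (rule derivative_eq_intros DERIV_cos_tf[OF w] DERIV_sin_tf[OF w] refl)+ simp

lemma partial_deriv_outcome_prob_proj:
  assumes "continuous_on UNIV w"
  shows "partial_deriv i (outcome_prob a k (proj a w)) = prob_deriv a k w (axis i 1)"
  by (rule ext) (simp add: partial_deriv_def DERIV_imp_deriv[OF DERIV_outcome_prob_proj[OF assms]])

lemma continuous_times_phase: "continuous_on UNIV w \<Longrightarrow> continuous_on UNIV (\<lambda>r. w r * phase k v r)"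
  by (intro continuous_intros continuous_phase)

text \<open>At s = 0 every sine transform vanishes, and so does the cosine transform of w, being a
  multiple of the mean of w. Of the product-rule terms only the product of the two first-order
  cosine transforms survives, and the Hessian has rank at most one.\<close>

lemma outcome_hessian_proj:
  assumes w: "continuous_on UNIV w" and zero: "(LINT r|disk a. w r) = 0"
  shows "outcome_hessian a k (proj a w) p q
    = 2 * (cos_tf a k (\<lambda>r. w r * phase k (axis p 1) r) 0 * cos_tf a k (\<lambda>r. w r * phase k (axis q 1) r) 0)"
proof -
  note c = continuous_times_phase[OF w]
  have "((\<lambda>t. prob_deriv a k w (axis q 1) (0 + t *\<^sub>R axis p 1)) has_real_derivative
     2 * (cos_tf a k (\<lambda>r. w r * phase k (axis p 1) r) 0 * cos_tf a k (\<lambda>r. w r * phase k (axis q 1) r) 0)) (at 0)"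
    unfolding prob_deriv_def
    by (rule derivative_eq_intros DERIV_cos_tf[OF w] DERIV_sin_tf[OF w] DERIV_cos_tf[OF c] DERIV_sin_tf[OF c] refl)+
       (simp add: sin_tf_0 cos_tf_0 zero)
  then show ?thesis
    unfolding outcome_hessian_def partial_deriv_outcome_prob_proj[OF w] partial_deriv_def
    by (intro DERIV_imp_deriv) simp
qed

lemma tendsto_prob_deriv:
  assumes "continuous_on UNIV w"
  shows "((\<lambda>t. prob_deriv a k w u (t *\<^sub>R v)) \<longlongrightarrow> 0) (at 0)"
proof -
  note t = tendsto_tf[OF assms, of a k v] tendsto_tf[OF continuous_times_phase[OF assms, of k u], of a k v]
  have "((\<lambda>t. prob_deriv a k w u (t *\<^sub>R v)) \<longlongrightarrow>
      2 * (0 * cos_tf a k (\<lambda>r. w r * phase k u r) 0 - cos_tf a k w 0 * 0)) (at 0)"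
    unfolding prob_deriv_def by (intro tendsto_intros t)
  then show ?thesis by simp
qed

lemma phase_sum: "phase k v r = (\<Sum>p\<in>UNIV. v$p * phase k (axis p 1) r)"
  by (simp add: phase_def sum_3 axis_def algebra_simps diff_divide_distrib)

lemma cos_tf_sum_phase:
  assumes w: "continuous_on UNIV w"
  shows "cos_tf a k (\<lambda>r. w r * phase k v r) s = (\<Sum>p\<in>UNIV. v$p * cos_tf a k (\<lambda>r. w r * phase k (axis p 1) r) s)"
proof -
  have "(\<lambda>r. w r * phase k v r) = (\<lambda>r. (v$1 * (w r * phase k (axis 1 1) r) + v$2 * (w r * phase k (axis 2 1) r))
     + v$3 * (w r * phase k (axis 3 1) r))"
    unfolding phase_sum[of k v] by (simp add: sum_3 algebra_simps)
  then show ?thesis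
    by (simp add: cos_tf_add cos_tf_scale sum_3 continuous_intros w continuous_phase)
qed

text \<open>Since w is orthogonal to constants, the mean subtracted in the centred phase contributes
  nothing. This reconciles the quantum side, which involves centred phases, with the classical side,
  which involves plain ones.\<close>

lemma cos_tf_centered_phase_0:
  assumes w: "continuous_on UNIV w" and zero: "(LINT r|disk a. w r) = 0"
  shows "cos_tf a k (\<lambda>r. w r * centered_phase a k i r) 0 = cos_tf a k (\<lambda>r. w r * phase k (axis i 1) r) 0"
proof -
  define m where "m = (LINT r'|disk a. phase k (axis i 1) r') / (pi * a\<^sup>2)"
  have "(\<lambda>r. w r * centered_phase a k i r) = (\<lambda>r. w r * phase k (axis i 1) r + (- m) * w r)"
    by (auto simp: centered_phase_def m_def algebra_simps)
  moreover have "cos_tf a k w 0 = 0" by (simp add: cos_tf_0 zero)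
  ultimately show ?thesis
    by (simp only: cos_tf_add[OF continuous_times_phase[OF w] continuous_on_mult_left[OF w]] cos_tf_scale)
qed

lemma tendsto_quantum_fisher_proj:
  assumes "a > 0" "k > 0" "v \<noteq> 0" and w: "continuous_on UNIV w" and zero: "(LINT r|disk a. w r) = 0"
  shows "((\<lambda>t. quantum_fisher a k (proj a w) (t *\<^sub>R v) $ i $ j) \<longlongrightarrow>
    4 * (cos_tf a k (\<lambda>r. w r * phase k (axis i 1) r) 0 * cos_tf a k (\<lambda>r. w r * phase k (axis j 1) r) 0)) (at 0)"
proof (rule tendsto_quantum_fisher[OF assms(3) quantum_fisher_proj[OF assms(1,2) w]])
  have c: "continuous_on UNIV (\<lambda>r. w r * centered_phase a k i r)" for i
    by (intro continuous_intros w continuous_centered_phase)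
  have "((\<lambda>t. 4 * (sin_tf a k (\<lambda>r. w r * centered_phase a k i r) (t *\<^sub>R v) * sin_tf a k (\<lambda>r. w r * centered_phase a k j r) (t *\<^sub>R v)
       + cos_tf a k (\<lambda>r. w r * centered_phase a k i r) (t *\<^sub>R v) * cos_tf a k (\<lambda>r. w r * centered_phase a k j r) (t *\<^sub>R v))) \<longlongrightarrow>
    4 * (0 * 0 + cos_tf a k (\<lambda>r. w r * centered_phase a k i r) 0 * cos_tf a k (\<lambda>r. w r * centered_phase a k j r) 0)) (at 0)"
    by (intro tendsto_intros tendsto_tf[OF c])
  then show "((\<lambda>t. 4 * (sin_tf a k (\<lambda>r. w r * centered_phase a k i r) (t *\<^sub>R v) * sin_tf a k (\<lambda>r. w r * centered_phase a k j r) (t *\<^sub>R v)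
       + cos_tf a k (\<lambda>r. w r * centered_phase a k i r) (t *\<^sub>R v) * cos_tf a k (\<lambda>r. w r * centered_phase a k j r) (t *\<^sub>R v))) \<longlongrightarrow>
    4 * (cos_tf a k (\<lambda>r. w r * phase k (axis i 1) r) 0 * cos_tf a k (\<lambda>r. w r * phase k (axis j 1) r) 0)) (at 0)"
    by (simp add: cos_tf_centered_phase_0[OF w zero])
qed

text \<open>Along $tv$ both $\partial_i h$ and $h$ vanish as $t \to 0$, to first and second order in $t$;
  numerator and denominator of the classical Fisher information are therefore divided by $t^2$.\<close>

lemma tendsto_classical_fisher_proj:
  assumes w: "continuous_on UNIV w" and zero: "(LINT r|disk a. w r) = 0"
    and nz: "cos_tf a k (\<lambda>r. w r * phase k v r) 0 \<noteq> 0"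
  shows "((\<lambda>t. classical_fisher a k (proj a w) (t *\<^sub>R v) $ i $ j) \<longlongrightarrow>
    4 * (cos_tf a k (\<lambda>r. w r * phase k (axis i 1) r) 0 * cos_tf a k (\<lambda>r. w r * phase k (axis j 1) r) 0)) (at 0)"
proof -
  note c = continuous_times_phase[OF w]
  define \<beta> where "\<beta> u = cos_tf a k (\<lambda>r. w r * phase k u r) 0" for u
  \<comment> \<open>\<open>x\<close> and \<open>y\<close> are difference quotients at 0 of
    transforms that vanish there. Their limits are derivatives: 0 for the cosine transform and
    \<beta> v for the sine transform, so the rescaled denominator tends to (\<beta> v)^2.\<close>
  define x where "x t = cos_tf a k w (t *\<^sub>R v) / t" for t
  define y where "y t = sin_tf a k w (t *\<^sub>R v) / t" for t
  define C where "C i t = cos_tf a k (\<lambda>r. w r * phase k (axis i 1) r) (t *\<^sub>R v)" for i t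
  define S where "S i t = sin_tf a k (\<lambda>r. w r * phase k (axis i 1) r) (t *\<^sub>R v)" for i t
  have x: "(x \<longlongrightarrow> 0) (at 0)"
    using DERIV_cos_tf[OF w, of a k 0 v 0] by (simp add: DERIV_def x_def[abs_def] cos_tf_0 zero sin_tf_0)
  have y: "(y \<longlongrightarrow> \<beta> v) (at 0)"
    using DERIV_sin_tf[OF w, of a k 0 v 0] by (simp add: DERIV_def y_def[abs_def] \<beta>_def sin_tf_0)
  have CS: "(C i \<longlongrightarrow> \<beta> (axis i 1)) (at 0)" "(S i \<longlongrightarrow> 0) (at 0)" for i
    unfolding C_def[abs_def] S_def[abs_def] \<beta>_def by (rule tendsto_tf[OF c])+
  have "((\<lambda>t. (2 * (y t * C i t - x t * S i t)) * (2 * (y t * C j t - x t * S j t)) / ((x t)\<^sup>2 + (y t)\<^sup>2)) \<longlongrightarrow>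
      (2 * (\<beta> v * \<beta> (axis i 1) - 0 * 0)) * (2 * (\<beta> v * \<beta> (axis j 1) - 0 * 0)) / (0\<^sup>2 + (\<beta> v)\<^sup>2)) (at 0)"
    by (intro tendsto_intros x y CS) (use nz in \<open>simp add: \<beta>_def\<close>)
  also have "(2 * (\<beta> v * \<beta> (axis i 1) - 0 * 0)) * (2 * (\<beta> v * \<beta> (axis j 1) - 0 * 0)) / (0\<^sup>2 + (\<beta> v)\<^sup>2)
      = 4 * (\<beta> (axis i 1) * \<beta> (axis j 1))"
    using nz by (simp add: \<beta>_def[symmetric] power2_eq_square)
  finally show ?thesis
    unfolding \<beta>_def
  proof (rule Lim_transform_eventually)
    have "\<forall>\<^sub>F t :: real in at 0. t \<noteq> 0" by (simp add: eventually_at_filter)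
    then show "\<forall>\<^sub>F t in at 0. (2 * (y t * C i t - x t * S i t)) * (2 * (y t * C j t - x t * S j t)) / ((x t)\<^sup>2 + (y t)\<^sup>2)
        = classical_fisher a k (proj a w) (t *\<^sub>R v) $ i $ j"
    proof eventually_elim
      case (elim t)
      have e: "cos_tf a k w (t *\<^sub>R v) = t * x t" "sin_tf a k w (t *\<^sub>R v) = t * y t"
        using elim by (simp_all add: x_def y_def)
      have "classical_fisher a k (proj a w) (t *\<^sub>R v) $ i $ j =
          (2 * (t * y t * C i t - t * x t * S i t)) * (2 * (t * y t * C j t - t * x t * S j t)) / ((t * x t)\<^sup>2 + (t * y t)\<^sup>2)"
        unfolding classical_fisher_def partial_deriv_outcome_prob_proj[OF w] prob_deriv_def
          outcome_prob_proj[OF w] e C_def S_def by simp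
      also have "\<dots> = (t\<^sup>2 * ((2 * (y t * C i t - x t * S i t)) * (2 * (y t * C j t - x t * S j t)))) /
          (t\<^sup>2 * ((x t)\<^sup>2 + (y t)\<^sup>2))"
        by (rule arg_cong2[where f = "(/)"]) (simp_all add: power2_eq_square algebra_simps)
      finally show ?case using elim by simp
    qed
  qed
qed

text \<open>The mean of w is its overlap with the state at s = 0 up to a factor, so the projector is
  null. The Hessian form at v equals 2 (\<beta> v)^2: where it is positive, the classical limit
  exists and agrees with the quantum one. If the Hessian is zero, then every \<beta> of a unit
  vector vanishes, and with it the quantum limit.\<close>

lemma saturated_proj:
  assumes a: "a > 0" and k: "k > 0" and w: "continuous_on UNIV w" and zero: "(LINT r|disk a. w r) = 0"
  shows "saturated a k (proj a w)"
proof -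
  define \<beta> where "\<beta> u = cos_tf a k (\<lambda>r. w r * phase k u r) 0" for u
  have h0: "outcome_prob a k (proj a w) 0 = 0"
    by (simp add: outcome_prob_proj[OF w] cos_tf_0 sin_tf_0 zero)
  have hess: "outcome_hessian a k (proj a w) p q = 2 * (\<beta> (axis p 1) * \<beta> (axis q 1))" for p q
    unfolding \<beta>_def by (rule outcome_hessian_proj[OF w zero])
  have "same_limit_along a k (proj a w) v"
    if pos: "(\<Sum>p\<in>UNIV. \<Sum>q\<in>UNIV. outcome_hessian a k (proj a w) p q * v$p * v$q) > 0" for v
  proof -
    have "(\<Sum>p\<in>UNIV. \<Sum>q\<in>UNIV. outcome_hessian a k (proj a w) p q * v$p * v$q) = 2 * (\<beta> v)\<^sup>2"
      unfolding hess \<beta>_def cos_tf_sum_phase[OF w, of a k v]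
      by (simp add: sum_3 power2_eq_square algebra_simps)
    with pos have nz: "\<beta> v \<noteq> 0" by auto
    have v: "v \<noteq> 0" using pos by auto
    show ?thesis
      unfolding same_limit_along_def \<beta>_def
      by (intro exI[of _ "\<chi> i j. 4 * (\<beta> (axis i 1) * \<beta> (axis j 1))", unfolded \<beta>_def]
          conjI tendsto_matrix tendsto_classical_fisher_proj[OF w zero nz[unfolded \<beta>_def]]
          tendsto_quantum_fisher_proj[OF a k v w zero])
  qed
  moreover have "((\<lambda>t. quantum_fisher a k (proj a w) (t *\<^sub>R v)) \<longlongrightarrow> 0) (at 0)"
    if "\<forall>p q. outcome_hessian a k (proj a w) p q = 0" and v: "v \<noteq> 0" for v
  proof -
    have "\<beta> (axis p 1) = 0" for p using that(1)[rule_format, of p p] by (simp add: hess)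
    then have "((\<lambda>t. quantum_fisher a k (proj a w) (t *\<^sub>R v)) \<longlongrightarrow> (\<chi> i j. 0)) (at 0)"
      using tendsto_quantum_fisher_proj[OF a k v w zero] unfolding \<beta>_def by (intro tendsto_matrix) simp
    moreover have "(\<chi> i j. 0) = (0 :: real^3^3)" by (simp add: vec_eq_iff)
    ultimately show ?thesis by simp
  qed
  ultimately show ?thesis unfolding saturated_def h0 by simp
qed

section \<open>The complementary projector\<close>

lemma outcome_prob_diff:
  assumes "bounded_oper a P" "selfadjoint_oper a P" "bounded_oper a Q" "selfadjoint_oper a Q"
  shows "outcome_prob a k (\<lambda>f r. P f r - Q f r) s = outcome_prob a k P s - outcome_prob a k Q s"
  using assms
  by (simp add: outcome_prob_eq bounded_oper_diff selfadjoint_oper_diff braket_diff_left bounded_operD(1) wave_L2)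

text \<open>Linearity in the operator, valid for all bounded self-adjoint operators, lets the
  rank-one projectors be subtracted one at a time.\<close>

lemma quantum_fisher_diff:
  assumes "a > 0" "k > 0" "s \<noteq> 0" "bounded_oper a P" "selfadjoint_oper a P" "bounded_oper a Q" "selfadjoint_oper a Q"
  shows "quantum_fisher a k (\<lambda>f r. P f r - Q f r) s $ i $ j
    = quantum_fisher a k P s $ i $ j - quantum_fisher a k Q s $ i $ j"
  using assms
  by (simp add: quantum_fisher_eq bounded_oper_diff selfadjoint_oper_diff braket_diff_right bounded_operD(1) wave_L2)

lemma outcome_prob_id:
  assumes "a > 0"
  shows "outcome_prob a k (\<lambda>f. f) s = 1"
proof -
  have "outcome_prob a k (\<lambda>f. f) s = (LINT r|disk a. cos_wave a k s r * cos_wave a k s r)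
      + (LINT r|disk a. sin_wave a k s r * sin_wave a k s r)"
    by (simp add: outcome_prob_eq[OF bounded_oper_id selfadjoint_oper_id] braket_rwave)
  also have "\<dots> = (LINT r|disk a. cos_wave a k s r * cos_wave a k s r + sin_wave a k s r * sin_wave a k s r)"
    by (intro Bochner_Integration.integral_add[symmetric] integrable_disk_continuous continuous_intros
      continuous_cos_wave continuous_sin_wave)
  also have "\<dots> = 1"
    unfolding cos_wave_sin_wave_square[OF assms] integral_disk_const[OF assms] using assms by simp
  finally show ?thesis .
qed

text \<open>As C^2 + S^2 is constant, s drops out. What remains is four times the covariance of the
  phase derivatives under the uniform distribution on the disk.\<close>

lemma quantum_fisher_id:
  assumes a: "a > 0" and k: "k > 0" and s: "s \<noteq> 0"
  shows "quantum_fisher a k (\<lambda>f. f) s $ i $ j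
    = 4 / (pi * a\<^sup>2) * (LINT r|disk a. centered_phase a k i r * centered_phase a k j r)"
proof -
  have "quantum_fisher a k (\<lambda>f. f) s $ i $ j = (LINT r|disk a. sld_cos a k i s r * sld_cos a k j s r)
      + (LINT r|disk a. sld_sin a k i s r * sld_sin a k j s r)"
    by (simp add: quantum_fisher_eq[OF a k s bounded_oper_id selfadjoint_oper_id] braket_rwave)
  also have "\<dots> = (LINT r|disk a. sld_cos a k i s r * sld_cos a k j s r + sld_sin a k i s r * sld_sin a k j s r)"
    by (intro Bochner_Integration.integral_add[symmetric] integrable_disk_continuous continuous_intros
      continuous_sld_cos continuous_sld_sin)
  also have "\<dots> = (LINT r|disk a. (4 * (1 / (pi * a\<^sup>2))) * (centered_phase a k i r * centered_phase a k j r))"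
  proof (intro Bochner_Integration.integral_cong refl)
    fix r
    show "sld_cos a k i s r * sld_cos a k j s r + sld_sin a k i s r * sld_sin a k j s r
        = (4 * (1 / (pi * a\<^sup>2))) * (centered_phase a k i r * centered_phase a k j r)"
      unfolding cos_wave_sin_wave_square[OF a, symmetric, of k s r] sld_cos_def sld_sin_def
      by (simp add: algebra_simps)
  qed
  also have "\<dots> = (4 * (1 / (pi * a\<^sup>2))) * (LINT r|disk a. centered_phase a k i r * centered_phase a k j r)"
    by (rule integral_mult_right_zero)
  finally show ?thesis by simp
qed

text \<open>The outcome is certain at $s = 0$, so its classical information vanishes in the limit; by the
  Parseval hypothesis the centred phases lie in the kernel of the projector, and so does its quantum
  information.\<close>

lemma saturated_complement:
  assumes a: "a > 0" and k: "k > 0"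
    and w: "continuous_on UNIV w1" "continuous_on UNIV w2" "continuous_on UNIV w3"
    and zero: "(LINT r|disk a. w1 r) = 0" "(LINT r|disk a. w2 r) = 0" "(LINT r|disk a. w3 r) = 0"
    and parseval: "\<And>i j. (LINT r|disk a. centered_phase a k i r * centered_phase a k j r) =
        (LINT r|disk a. w1 r * centered_phase a k i r) * (LINT r|disk a. w1 r * centered_phase a k j r)
      + (LINT r|disk a. w2 r * centered_phase a k i r) * (LINT r|disk a. w2 r * centered_phase a k j r)
      + (LINT r|disk a. w3 r * centered_phase a k i r) * (LINT r|disk a. w3 r * centered_phase a k j r)"
  shows "saturated a k (\<lambda>f r. f r - proj a w1 f r - proj a w2 f r - proj a w3 f r)"
proof -
  let ?P = "\<lambda>f r. f r - proj a w1 f r - proj a w2 f r - proj a w3 f r"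
  note bs = bounded_oper_proj[OF w(1)] bounded_oper_proj[OF w(2)] bounded_oper_proj[OF w(3)]
    selfadjoint_oper_proj[OF w(1)] selfadjoint_oper_proj[OF w(2)] selfadjoint_oper_proj[OF w(3)]
  have bs': "bounded_oper a (\<lambda>f r. f r - proj a w1 f r)" "selfadjoint_oper a (\<lambda>f r. f r - proj a w1 f r)"
    "bounded_oper a (\<lambda>f r. f r - proj a w1 f r - proj a w2 f r)"
    "selfadjoint_oper a (\<lambda>f r. f r - proj a w1 f r - proj a w2 f r)"
    by (intro bounded_oper_diff selfadjoint_oper_diff bs bounded_oper_id selfadjoint_oper_id)+
  have h: "outcome_prob a k ?P s = 1 - outcome_prob a k (proj a w1) s - outcome_prob a k (proj a w2) s
      - outcome_prob a k (proj a w3) s" for s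
    by (simp add: outcome_prob_diff[OF bs'(3,4) bs(3,6)] outcome_prob_diff[OF bs'(1,2) bs(2,5)]
        outcome_prob_diff[OF bounded_oper_id selfadjoint_oper_id bs(1,4)] outcome_prob_id[OF a])
  have h0: "outcome_prob a k ?P 0 = 1"
    by (simp add: h outcome_prob_proj w cos_tf_0 sin_tf_0 zero)
  have d: "partial_deriv i (outcome_prob a k ?P) s = 0 - prob_deriv a k w1 (axis i 1) s
      - prob_deriv a k w2 (axis i 1) s - prob_deriv a k w3 (axis i 1) s" for i s
    unfolding partial_deriv_def h
    by (intro DERIV_imp_deriv DERIV_diff DERIV_const DERIV_outcome_prob_proj w)
  have q: "quantum_fisher a k ?P s $ i $ j = quantum_fisher a k (\<lambda>f. f) s $ i $ j
      - quantum_fisher a k (proj a w1) s $ i $ j - quantum_fisher a k (proj a w2) s $ i $ j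
      - quantum_fisher a k (proj a w3) s $ i $ j" if s: "s \<noteq> 0" for s i j
    by (simp add: quantum_fisher_diff[OF a k s bs'(3,4) bs(3,6)] quantum_fisher_diff[OF a k s bs'(1,2) bs(2,5)]
        quantum_fisher_diff[OF a k s bounded_oper_id selfadjoint_oper_id bs(1,4)])
  have "same_limit_along a k ?P v" if v: "v \<noteq> 0" for v
  proof -
    have prob: "((\<lambda>t. outcome_prob a k (proj a u) (t *\<^sub>R v)) \<longlongrightarrow> 0) (at 0)"
      if "continuous_on UNIV u" "(LINT r|disk a. u r) = 0" for u
    proof -
      have "((\<lambda>t. (cos_tf a k u (t *\<^sub>R v))\<^sup>2 + (sin_tf a k u (t *\<^sub>R v))\<^sup>2) \<longlongrightarrow> (cos_tf a k u 0)\<^sup>2 + 0\<^sup>2) (at 0)"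
        by (intro tendsto_intros tendsto_tf that(1))
      then show ?thesis by (simp add: outcome_prob_proj[OF that(1)] cos_tf_0 that(2))
    qed
    have F: "((\<lambda>t. classical_fisher a k ?P (t *\<^sub>R v) $ i $ j) \<longlongrightarrow> 0) (at 0)" for i j
    proof -
      have "((\<lambda>t. classical_fisher a k ?P (t *\<^sub>R v) $ i $ j) \<longlongrightarrow>
          (0 - 0 - 0 - 0) * (0 - 0 - 0 - 0) / (1 - 0 - 0 - 0)) (at 0)"
        unfolding classical_fisher_def vec_lambda_beta d h
        by (intro tendsto_intros tendsto_prob_deriv prob w zero) simp
      then show ?thesis by simp
    qed
    have Q: "((\<lambda>t. quantum_fisher a k ?P (t *\<^sub>R v) $ i $ j) \<longlongrightarrow> 0) (at 0)" for i j
    proof -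
      \<comment> \<open>The amplitude of the waves. Each cosine transform at 0 carries one factor N,
        so a product of two carries N^2 = 1/(pi a^2), the factor in the information of the identity;
        the two can then cancel by the Parseval hypothesis.\<close>
      define N where "N = 1 / (sqrt pi * a)"
      have N: "N * N = 1 / (pi * a\<^sup>2)" using a by (simp add: N_def power2_eq_square field_simps)
      define I where "I u i = (LINT r|disk a. u r * centered_phase a k i r)" for u i
      have lim: "((\<lambda>t. quantum_fisher a k (proj a u) (t *\<^sub>R v) $ i $ j) \<longlongrightarrow> 4 * ((N * I u i) * (N * I u j))) (at 0)"
        if u: "continuous_on UNIV u" "(LINT r|disk a. u r) = 0" for u
        using tendsto_quantum_fisher_proj[OF a k v u, of i j, folded cos_tf_centered_phase_0[OF u]]
        unfolding cos_tf_0 I_def N_def .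
      have id: "((\<lambda>t. quantum_fisher a k (\<lambda>f. f) (t *\<^sub>R v) $ i $ j) \<longlongrightarrow>
          4 * (N * N) * (LINT r|disk a. centered_phase a k i r * centered_phase a k j r)) (at 0)"
        by (rule tendsto_quantum_fisher[OF v quantum_fisher_id[OF a k]]) (simp_all add: N)
      have "((\<lambda>t. quantum_fisher a k ?P (t *\<^sub>R v) $ i $ j) \<longlongrightarrow>
          4 * (N * N) * (LINT r|disk a. centered_phase a k i r * centered_phase a k j r)
          - 4 * ((N * I w1 i) * (N * I w1 j)) - 4 * ((N * I w2 i) * (N * I w2 j)) - 4 * ((N * I w3 i) * (N * I w3 j))) (at 0)"
        by (rule tendsto_quantum_fisher[OF v q], assumption) (intro tendsto_intros id lim w zero)
      then show ?thesis unfolding parseval I_def[symmetric] by (simp add: algebra_simps)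
    qed
    show ?thesis
      unfolding same_limit_along_def by (intro exI[of _ "\<chi> i j. 0"] conjI tendsto_matrix F Q)
  qed
  then show ?thesis unfolding saturated_def h0 by simp
qed

lemma projective_measurement_complement:
  assumes L2: "z1 \<in> L2 a" "z2 \<in> L2 a" "z3 \<in> L2 a"
    and orth: "braket a z1 z1 = 1" "braket a z2 z2 = 1" "braket a z3 z3 = 1"
      "braket a z1 z2 = 0" "braket a z1 z3 = 0" "braket a z2 z3 = 0"
  shows "projective_measurement a
    [\<lambda>f r. f r - ketbra a z1 z1 f r - ketbra a z2 z2 f r - ketbra a z3 z3 f r,
     ketbra a z1 z1, ketbra a z2 z2, ketbra a z3 z3]"
proof -
  have orth': "braket a z2 z1 = 0" "braket a z3 z1 = 0" "braket a z3 z2 = 0"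
    using orth(4-6) by (metis braket_cnj complex_cnj_zero)+
  note lin = ketbra_def comp_def braket_linear L2_intros L2 orth orth'
  show ?thesis
    unfolding projective_measurement_def
  proof (intro conjI)
    show "\<forall>P\<in>set [\<lambda>f r. f r - ketbra a z1 z1 f r - ketbra a z2 z2 f r - ketbra a z3 z3 f r,
        ketbra a z1 z1, ketbra a z2 z2, ketbra a z3 z3]. bounded_oper a P \<and> selfadjoint_oper a P"
      by (auto intro!: bounded_oper_diff selfadjoint_oper_diff bounded_oper_id selfadjoint_oper_id
          bounded_oper_ketbra selfadjoint_oper_ketbra L2)
  next
    show "oper_eq a (\<lambda>f r. \<Sum>P\<leftarrow>[\<lambda>f r. f r - ketbra a z1 z1 f r - ketbra a z2 z2 f r - ketbra a z3 z3 f r,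
        ketbra a z1 z1, ketbra a z2 z2, ketbra a z3 z3]. P f r) (\<lambda>f. f)"
      by (simp add: oper_eq_def)
  next
    let ?Ps = "[\<lambda>f r. f r - ketbra a z1 z1 f r - ketbra a z2 z2 f r - ketbra a z3 z3 f r,
        ketbra a z1 z1, ketbra a z2 z2, ketbra a z3 z3]"
    have four: "i \<in> {0, 1, 2, 3}" if "i < length ?Ps" for i using that by auto
    show "\<forall>i<length ?Ps. \<forall>j<length ?Ps. oper_eq a (?Ps ! i \<circ> ?Ps ! j) (if i = j then ?Ps ! i else (\<lambda>f r. 0))"
    proof (intro allI impI)
      fix i j assume i: "i < length ?Ps" and j: "j < length ?Ps"
      from four[OF i] four[OF j] show "oper_eq a (?Ps ! i \<circ> ?Ps ! j) (if i = j then ?Ps ! i else (\<lambda>f r. 0))"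
        unfolding oper_eq_def
        by (auto simp: lin eval_nat_numeral)
    qed
  qed
qed

subsection \<open>The first Zernike functions\<close>

text \<open>The polar angle is discontinuous, but multiplied by the radius its cosine and sine
  become Cartesian coordinates. The identity also holds at the origin, where both sides are 0, so
  the tilts are globally continuous functions.\<close>

lemma norm_times_cos_polar_angle: "norm r * cos (polar_angle r) = fst r"
  and norm_times_sin_polar_angle: "norm r * sin (polar_angle r) = snd r"
proof -
  let ?z = "Complex (fst r) (snd r)"
  have n: "norm r = cmod ?z" by (simp add: norm_prod_def cmod_def)
  have "rcis (cmod ?z) (Arg ?z) = ?z" by (rule rcis_cmod_Arg)
  then show "norm r * cos (polar_angle r) = fst r" "norm r * sin (polar_angle r) = snd r"
    unfolding polar_angle_def n by (metis Re_rcis complex.sel(1), metis Im_rcis complex.sel(2))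
qed

lemma zernike_rwave:
  assumes "zernike_unnormalized a n m = rwave u"
  shows "zernike a n m = rwave (\<lambda>r. u r / l2norm a (rwave u))"
  by (rule ext) (simp add: zernike_def assms rwave_def)

lemma zernike_unnormalized_1_1: "zernike_unnormalized a 1 1 = rwave (\<lambda>r. fst r / a)"
  by (rule ext) (simp add: zernike_unnormalized_def zernike_radial_def rwave_def norm_times_cos_polar_angle
    flip: of_real_mult)

lemma zernike_unnormalized_1_m1: "zernike_unnormalized a 1 (-1) = rwave (\<lambda>r. snd r / a)"
  by (rule ext) (simp add: zernike_unnormalized_def zernike_radial_def rwave_def norm_times_sin_polar_angle
    flip: of_real_mult)

lemma zernike_unnormalized_2_0: "zernike_unnormalized a 2 0 = rwave (\<lambda>r. 2 * (norm r / a)\<^sup>2 - 1)"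
  by (rule ext) (simp add: zernike_unnormalized_def zernike_radial_def rwave_def)

lemma l2norm_rwave_square:
  "(l2norm a (rwave u))\<^sup>2 = (LINT r|disk a. u r * u r)"
  unfolding l2norm_square rwave_def norm_of_real power2_abs by (simp only: power2_eq_square)

text \<open>Positivity from a single interior point lets the normalisation constants of the Zernike
  functions remain abstract: they are never evaluated.\<close>

lemma l2norm_rwave_pos:
  assumes "continuous_on UNIV u" "r \<in> ball 0 a" "u r \<noteq> 0"
  shows "l2norm a (rwave u) > 0"
proof -
  have "l2norm a (rwave u) \<noteq> 0"
  proof
    assume "l2norm a (rwave u) = 0"
    then have "(LINT r|disk a. (u r)\<^sup>2) = 0"
      using l2norm_rwave_square[of a u] by (simp add: power2_eq_square)
    with zero_if_integral_disk_square_zero[OF assms(1) _ assms(2)] assms(3) show False by blast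
  qed
  then show ?thesis using l2norm_nonneg[of a "rwave u"] by simp
qed

lemma integral_normalized:
  assumes "l2norm a (rwave u) > 0"
  shows "(LINT r|disk a. (u r / l2norm a (rwave u)) * (u r / l2norm a (rwave u))) = 1"
proof -
  have "(LINT r|disk a. (u r / l2norm a (rwave u)) * (u r / l2norm a (rwave u)))
      = (l2norm a (rwave u))\<^sup>2 / (l2norm a (rwave u) * l2norm a (rwave u))"
    unfolding l2norm_rwave_square by simp
  also have "\<dots> = 1" using assms by (simp add: power2_eq_square)
  finally show ?thesis .
qed

theorem mainTheorem12:
  fixes a k :: real
  assumes "a > 0" and "k > 0"
  defines "P2 \<equiv> ketbra a (zernike a 1 1) (zernike a 1 1)"
    and "P3 \<equiv> ketbra a (zernike a 1 (-1)) (zernike a 1 (-1))"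
    and "P4 \<equiv> ketbra a (zernike a 2 0) (zernike a 2 0)"
  defines "P1 \<equiv> (\<lambda>f r. f r - P2 f r - P3 f r - P4 f r)"
  shows "optimal_at_zero a k [P1, P2, P3, P4]"
proof -
  note a = assms(1) and k = assms(2)
  define u1 u2 u3 :: "real \<times> real \<Rightarrow> real"
    where "u1 = (\<lambda>r. fst r / a)" and "u2 = (\<lambda>r. snd r / a)" and "u3 = (\<lambda>r. 2 * (norm r / a)\<^sup>2 - 1)"
  define n1 n2 n3 where "n1 = l2norm a (rwave u1)" and "n2 = l2norm a (rwave u2)" and "n3 = l2norm a (rwave u3)"
  define w1 w2 w3 where "w1 = (\<lambda>r. u1 r / n1)" and "w2 = (\<lambda>r. u2 r / n2)" and "w3 = (\<lambda>r. u3 r / n3)"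
  note u_def = u1_def u2_def u3_def
  have cu: "continuous_on UNIV u1" "continuous_on UNIV u2" "continuous_on UNIV u3"
    unfolding u_def by (intro continuous_intros; use a in simp)+
  \<comment> \<open>Interior points with nonzero values: both tilts equal 1/2 halfway along their
    axis, and the radial function equals -1 at the centre.\<close>
  have n: "n1 > 0" "n2 > 0" "n3 > 0"
    unfolding n1_def n2_def n3_def
    using l2norm_rwave_pos[OF cu(1), of "(a / 2, 0)" a] l2norm_rwave_pos[OF cu(2), of "(0, a / 2)" a]
      l2norm_rwave_pos[OF cu(3), of 0 a] a by (simp_all add: u_def norm_Pair)
  have cw: "continuous_on UNIV w1" "continuous_on UNIV w2" "continuous_on UNIV w3"
    unfolding w1_def w2_def w3_def by (intro continuous_intros cu; use n in simp)+
  have z: "zernike a 1 1 = rwave w1" "zernike a 1 (-1) = rwave w2" "zernike a 2 0 = rwave w3"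
    unfolding w1_def w2_def w3_def n1_def n2_def n3_def u_def
    by (intro zernike_rwave zernike_unnormalized_1_1 zernike_unnormalized_1_m1 zernike_unnormalized_2_0)+
  have flip1: "w1 (-1 * fst r, 1 * snd r) = - w1 r" "w2 (-1 * fst r, 1 * snd r) = w2 r"
      "w3 (-1 * fst r, 1 * snd r) = w3 r"
    and flip2: "w1 (1 * fst r, -1 * snd r) = w1 r" "w2 (1 * fst r, -1 * snd r) = - w2 r"
      "w3 (1 * fst r, -1 * snd r) = w3 r" for r
    by (simp_all add: w1_def w2_def w3_def u_def norm_prod_def)
  have norm2: "(LINT r|disk a. (norm r)\<^sup>2) = pi * a^4 / 2" by (rule integral_disk_norm_square[OF a])
  have zero: "(LINT r|disk a. w1 r) = 0" "(LINT r|disk a. w2 r) = 0"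
    using integral_disk_odd[OF cw(1), of "-1" 1 a] integral_disk_odd[OF cw(2), of 1 "-1" a] flip1(1) flip2(2)
    by simp_all
  \<comment> \<open>A radial function is invariant under the reflections, so here the second moment
    of the disk is required: (2/a^2) (pi a^4/2) equals the area pi a^2.\<close>
  have zero3: "(LINT r|disk a. w3 r) = 0"
  proof -
    have "(LINT r|disk a. u3 r) = (LINT r|disk a. 2 / a\<^sup>2 * (norm r)\<^sup>2) - (LINT r|disk a. 1)"
      unfolding u3_def power_divide times_divide_eq_right times_divide_eq_left
      by (intro Bochner_Integration.integral_diff integrable_disk_continuous continuous_intros) (use a in auto)
    also have "\<dots> = 2 / a\<^sup>2 * (pi * a^4 / 2) - pi * a\<^sup>2 * 1"
      by (simp only: integral_mult_right_zero norm2 integral_disk_const[OF a])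
    also have "\<dots> = 0" using a by (simp add: field_simps power2_eq_square power4_eq_xxxx)
    finally show ?thesis by (simp add: w3_def)
  qed
  have unit: "(LINT r|disk a. w1 r * w1 r) = 1" "(LINT r|disk a. w2 r * w2 r) = 1" "(LINT r|disk a. w3 r * w3 r) = 1"
    unfolding w1_def w2_def w3_def n1_def n2_def n3_def
    by (intro integral_normalized n[unfolded n1_def n2_def n3_def])+
  have orth: "(LINT r|disk a. w1 r * w2 r) = 0" "(LINT r|disk a. w1 r * w3 r) = 0" "(LINT r|disk a. w2 r * w3 r) = 0"
    using integral_disk_odd[OF continuous_on_mult[OF cw(1,2)], of "-1" 1 a]
      integral_disk_odd[OF continuous_on_mult[OF cw(1,3)], of "-1" 1 a]
      integral_disk_odd[OF continuous_on_mult[OF cw(2,3)], of 1 "-1" a] flip1 flip2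
    by simp_all
  have orth': "(LINT r|disk a. w2 r * w1 r) = 0" "(LINT r|disk a. w3 r * w1 r) = 0" "(LINT r|disk a. w3 r * w2 r) = 0"
    using orth by (simp_all add: mult.commute)
  \<comment> \<open>The coefficients of the centred phases in the normalised functions;
    \<open>n1\<close>, \<open>n2\<close>, \<open>n3\<close> undo the normalisation. The third comes
    from -k |r|^2/2 = -(k a^2/4) (u3 + 1), whose constant part -(k a^2/4) is the mean removed by
    centring.\<close>
  define c where "c = (\<lambda>i :: 3. if i = 1 then k * a * n1 else if i = 2 then k * a * n2 else - (k * a\<^sup>2 / 4) * n3)"
  define w where "w = (\<lambda>i :: 3. if i = 1 then w1 else if i = 2 then w2 else w3)"
  have "phase k (axis 1 1) = (\<lambda>r. (k * a * n1) * w1 r)" "phase k (axis 2 1) = (\<lambda>r. (k * a * n2) * w2 r)"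
    "phase k (axis 3 1) = (\<lambda>r. (- (k * a\<^sup>2 / 4) * n3) * w3 r + (- (k * a\<^sup>2 / 4)))"
    using a n by (auto simp: phase_def axis_def w1_def w2_def w3_def u_def field_simps power2_eq_square)
  moreover have "(LINT r|disk a. (- (k * a\<^sup>2 / 4) * n3) * w3 r + (- (k * a\<^sup>2 / 4)))
      = (LINT r|disk a. (- (k * a\<^sup>2 / 4) * n3) * w3 r) + (LINT r|disk a. - (k * a\<^sup>2 / 4))"
    by (intro Bochner_Integration.integral_add integrable_disk_continuous continuous_intros cw)
  ultimately have "centered_phase a k 1 r = c 1 * w 1 r" "centered_phase a k 2 r = c 2 * w 2 r"
    "centered_phase a k 3 r = c 3 * w 3 r" for r
    using a by (simp_all only: centered_phase_def integral_mult_right_zero zero zero3 integral_disk_const[OF a])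
      (simp_all add: c_def w_def)
  then have cp: "centered_phase a k i r = c i * w i r" for i r
    using exhaust_3[of i] by blast
  have int_cp: "(LINT r|disk a. u r * centered_phase a k i r) = c i * (LINT r|disk a. u r * w i r)" for u i
    unfolding cp mult.left_commute[of "u _"] by (rule integral_mult_right_zero)
  have int_cp': "(LINT r|disk a. centered_phase a k i r * centered_phase a k j r) = c i * c j * (LINT r|disk a. w i r * w j r)" for i j
    unfolding int_cp unfolding cp by (simp add: mult.assoc)
  \<comment> \<open>Each centred phase is a multiple of a single member of the orthonormal triple,
    so at most one product on the right is nonzero, and only for i = j.\<close>
  have parseval: "(LINT r|disk a. centered_phase a k i r * centered_phase a k j r) =
        (LINT r|disk a. w1 r * centered_phase a k i r) * (LINT r|disk a. w1 r * centered_phase a k j r)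
      + (LINT r|disk a. w2 r * centered_phase a k i r) * (LINT r|disk a. w2 r * centered_phase a k j r)
      + (LINT r|disk a. w3 r * centered_phase a k i r) * (LINT r|disk a. w3 r * centered_phase a k j r)" for i j
    unfolding int_cp' unfolding int_cp using exhaust_3[of i] exhaust_3[of j]
    by (auto simp: w_def unit orth orth')
  have "saturated a k P1"
    unfolding P1_def P2_def P3_def P4_def z by (rule saturated_complement[OF a k cw zero zero3 parseval])
  moreover have "saturated a k P2" "saturated a k P3" "saturated a k P4"
    unfolding P2_def P3_def P4_def z by (intro saturated_proj a k cw zero zero3)+
  moreover have "projective_measurement a [P1, P2, P3, P4]"
    unfolding P1_def P2_def P3_def P4_def z
    by (intro projective_measurement_complement rwave_L2 cw) (simp_all add: braket_rwave unit orth)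
  ultimately show ?thesis by (simp add: optimal_at_zero_def)
qed

end
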